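(* Let $q=2$. Let $A=\begin{pmatrix}a_{11} & a_{12} \\ a_{21} & 0\end{pmatrix}$ with entries in $\mathbb{C}_\infty$, $\operatorname{ord}a_{11}=-1$, $a_{21}\neq0$, and put $v=\operatorname{ord}a_{21}$ and $t=\operatorname{ord}\left(\frac{\theta^2}{a_{21}}+\frac{\theta^4}{a_{21}^4}-a_{12}^2\right)$. If $v\ge2$ and $t\ge-\frac{16}7v-\frac{24}7$, then $h^1(M(A))=0$.
   Context: Let $q=2$ and $\theta$ a variable. $\mathbb{C}_\infty$ is the completion of an algebraic closure of the completion of $\mathbb{F}_q(\theta)$ at the valuation at infinity $\operatorname{ord}$, normalized by $\operatorname{ord}\theta=-1$ (and $\operatorname{ord}0=+\infty$). $\mathbb{C}_\infty[T,\tau]$ is the ring of non-commutative polynomials with relations $Ta=aT$, $T\tau=\tau T$, $\tau a=a^q\tau$ for $a\in\mathbb{C}_\infty$; $\mathbb{C}_\infty\{\tau\}$ is the subring generated over $\mathbb{C}_\infty$ by $\tau$. For a $2\times2$ matrix $A$ over $\mathbb{C}_\infty$, $M(A)$ is the left $\mathbb{C}_\infty[T,\tau]$-module (Anderson t-motive of dimension 2 and rank 4) which is free over $\mathbb{C}_\infty\{\tau\}$ with basis $e_1,e_2$, where multiplication by $T$ is given, for the column $e_*=(e_1,e_2)^t$, by $Te_*=\theta e_*+A\tau e_*+\tau^2e_*$. It is free of rank 4 over $\mathbb{C}_\infty[T]$. $\mathbb{C}_\infty\{T\}$ is the ring of power series $\sum_{i\ge0}a_iT^i$ with $a_i\in\mathbb{C}_\infty$,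 $a_i\to0$, on which $\tau$ acts by $\tau(\sum a_iT^i)=\sum a_i^qT^i$. On $M\otimes_{\mathbb{C}_\infty[T]}\mathbb{C}_\infty\{T\}$, $\tau$ acts by $\tau(m\otimes f)=\tau(m)\otimes\tau(f)$. $H^1(M)$ is the $\mathbb{F}_q[T]$-module of $\tau$-invariant elements of $M\otimes_{\mathbb{C}_\infty[T]}\mathbb{C}_\infty\{T\}$; it is free, and $h^1(M)$ is its rank over $\mathbb{F}_q[T]$. *)

theory Defs
  imports
    "HOL-Library.Extended_Real"
    "HOL-Analysis.Cartesian_Space"
    "HOL-Computational_Algebra.Polynomial_FPS"
    "HOL-Algebra.Algebraic_Closure_Type"
    "HOL-Algebra.Generated_Fields"
    "HOL-Algebra.Free_Abelian_Groups"
    "HOL-Algebra.Module"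
begin

section \<open>The field of characteristic two at infinity\<close>

definition is_valuation :: "('a::field \<Rightarrow> ereal) \<Rightarrow> bool" where
  "is_valuation ord \<longleftrightarrow>
     (\<forall>x. ord x = \<infinity> \<longleftrightarrow> x = 0) \<and>
     (\<forall>x. ord x \<noteq> -\<infinity>) \<and>
     (\<forall>x y. ord (x * y) = ord x + ord y) \<and>
     (\<forall>x y. min (ord x) (ord y) \<le> ord (x + y))"

definition ord_converges :: "('a::field \<Rightarrow> ereal) \<Rightarrow> (nat \<Rightarrow> 'a) \<Rightarrow> 'a \<Rightarrow> bool" where
  "ord_converges ord s l \<longleftrightarrow> (\<lambda>n. ord (s n - l)) \<longlonglongrightarrow> \<infinity>"

definition ord_Cauchy :: "('a::field \<Rightarrow> ereal) \<Rightarrow> (nat \<Rightarrow> 'a) \<Rightarrow> bool" where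
  "ord_Cauchy ord s \<longleftrightarrow>
     (\<forall>B::real. \<exists>N. \<forall>m\<ge>N. \<forall>n\<ge>N. ereal B \<le> ord (s m - s n))"

definition is_completion :: "('a::field \<Rightarrow> ereal) \<Rightarrow> 'a set \<Rightarrow> 'a set \<Rightarrow> bool" where
  "is_completion ord L K \<longleftrightarrow>
     K \<subseteq> L \<and>
     (\<forall>s. range s \<subseteq> L \<longrightarrow> ord_Cauchy ord s \<longrightarrow> (\<exists>l\<in>L. ord_converges ord s l)) \<and>
     (\<forall>l\<in>L. \<exists>s. range s \<subseteq> K \<and> ord_converges ord s l)"

text \<open>
  The whole type \<^typ>\<open>'a\<close> is the completion of an algebraic closure \<open>L\<close> of the completion \<open>K\<close>
  of \<open>F\<^sub>2(\<theta>)\<close>. In characteristic two \<open>generate_field\<close> of \<open>\<theta>\<close> is \<open>F\<^sub>2(\<theta>)\<close>, and a valuation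
  with \<open>ord \<theta> = -1\<close> takes the value \<open>-deg f\<close> on every nonzero polynomial \<open>f\<close> in \<open>\<theta>\<close>
  over \<open>F\<^sub>2\<close>. Hence \<open>\<theta>\<close> is transcendental and \<open>ord\<close> restricts to the
  valuation at infinity. These conditions determine the valued field up to isomorphism.
\<close>

definition is_C_infinity :: "('a::field \<Rightarrow> ereal) \<Rightarrow> 'a \<Rightarrow> bool" where
  "is_C_infinity ord \<theta> \<longleftrightarrow>
     CHAR('a) = 2 \<and> is_valuation ord \<and> ord \<theta> = -1 \<and>
     (\<exists>K L. is_completion ord K (generate_field (ring_of_type_algebra :: 'a ring) {\<theta>}) \<and>
            algebraic_closure ((ring_of_type_algebra :: 'a ring) \<lparr>carrier := L\<rparr>) K \<and>
            is_completion ord UNIV L)"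

section \<open>The t-motive\<close>

text \<open>
  An element \<open>\<Sum> c\<^sub>i \<tau>\<^sup>i\<close> of the twisted polynomial ring is stored as its coefficient
  polynomial. Only the additive structure of \<^typ>\<open>'a poly\<close> is then meaningful; the product is
  \<open>skew_mult\<close>, determined by \<open>\<tau> a = a\<^sup>2 \<tau>\<close>.
\<close>

type_synonym 'a skew_poly = "'a poly"

definition skew_mult :: "'a::field skew_poly \<Rightarrow> 'a skew_poly \<Rightarrow> 'a skew_poly" where
  "skew_mult f g =
     (\<Sum>i\<le>Polynomial.degree f. \<Sum>j\<le>Polynomial.degree g.
        Polynomial.monom (Polynomial.coeff f i * Polynomial.coeff g j ^ (2 ^ i)) (i + j))"

text \<open>
  The free left module over the twisted polynomial ring with basis \<open>motive_basis i\<close>, and its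
  endomorphism \<open>T\<close>. As \<open>T\<close> commutes with scalars and with \<open>\<tau>\<close>, it is determined by
  \<open>T e\<^sub>i = \<theta> e\<^sub>i + \<Sum>\<^sub>j A\<^sub>i\<^sub>j \<tau> e\<^sub>j + \<tau>\<^sup>2 e\<^sub>i\<close>.
\<close>

definition skew_act :: "'a::field skew_poly \<Rightarrow> 'a skew_poly ^ 'n \<Rightarrow> 'a skew_poly ^ 'n" where
  "skew_act f m = (\<chi> j. skew_mult f (m $ j))"

definition motive_basis :: "'n::finite \<Rightarrow> 'a::field skew_poly ^ 'n" where
  "motive_basis i = axis i 1"

definition motive_tau :: "'a::field skew_poly ^ 'n \<Rightarrow> 'a skew_poly ^ 'n" where
  "motive_tau m = skew_act [:0, 1:] m"

definition motive_T ::
    "'a::field \<Rightarrow> 'a ^ 'n ^ 'n \<Rightarrow> 'a skew_poly ^ 'n::finite \<Rightarrow> 'a skew_poly ^ 'n" where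
  "motive_T \<theta> A m =
     (\<Sum>i\<in>UNIV. skew_act (m $ i)
        (skew_act [:\<theta>:] (motive_basis i)
         + (\<Sum>j\<in>UNIV. skew_act [:A $ i $ j:] (motive_tau (motive_basis j)))
         + motive_tau (motive_tau (motive_basis i))))"

lemma skew_act_0_left: "skew_act 0 m = 0"
  by (simp add: skew_act_def skew_mult_def vec_eq_iff)

lemma skew_act_1_left: "skew_act 1 m = m"
  by (simp add: skew_act_def skew_mult_def vec_eq_iff poly_as_sum_of_monoms)

lemma motive_T_basis:
  "motive_T \<theta> A (motive_basis i) =
     skew_act [:\<theta>:] (motive_basis i)
     + (\<Sum>j\<in>UNIV. skew_act [:A $ i $ j:] (motive_tau (motive_basis j)))
     + motive_tau (motive_tau (motive_basis i))"
proof -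
  have "skew_act (motive_basis i $ k) m = (if k = i then m else 0)" for k and m :: "'a poly ^ 'b"
    by (simp add: motive_basis_def axis_def skew_act_0_left skew_act_1_left)
  then show ?thesis
    by (simp add: motive_T_def)
qed

text \<open>\<open>M(A)\<close> as a module over \<open>C\<^sub>\<infinity>[T]\<close>. The ring multiplication
  and unit of a module record are irrelevant for modules.\<close>

definition motive ::
    "'a::field \<Rightarrow> 'a ^ 'n ^ 'n \<Rightarrow> ('a poly, 'a skew_poly ^ 'n::finite) module" where
  "motive \<theta> A =
     \<lparr>carrier = UNIV, monoid.mult = (\<lambda>_ _. undefined), one = undefined,
      ring.zero = 0, add = (+),
      module.smult = (\<lambda>p m. \<Sum>k\<le>Polynomial.degree p.
                   skew_act [:Polynomial.coeff p k:] ((motive_T \<theta> A ^^ k) m))\<rparr>"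

section \<open>Convergent power series\<close>

definition tate_carrier :: "('a::field \<Rightarrow> ereal) \<Rightarrow> 'a fps set" where
  "tate_carrier ord = {f. (\<lambda>i. ord (fps_nth f i)) \<longlonglongrightarrow> \<infinity>}"

definition tate :: "('a::field \<Rightarrow> ereal) \<Rightarrow> ('a poly, 'a fps) module" where
  "tate ord =
     \<lparr>carrier = tate_carrier ord, monoid.mult = (*), one = 1,
      ring.zero = 0, add = (+), module.smult = (\<lambda>p f. fps_of_poly p * f)\<rparr>"

definition tate_tau :: "'a::field fps \<Rightarrow> 'a fps" where
  "tate_tau f = Abs_fps (\<lambda>i. fps_nth f i ^ 2)"

section \<open>Tensor products of modules\<close>

definition tensor_free ::
    "('r, 'm) module \<Rightarrow> ('r, 'n) module \<Rightarrow> ('m \<times> 'n \<Rightarrow>\<^sub>0 int) monoid" where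
  "tensor_free M N = free_Abelian_group (carrier M \<times> carrier N)"

definition tensor_relations ::
    "'r ring \<Rightarrow> ('r, 'm) module \<Rightarrow> ('r, 'n) module \<Rightarrow> ('m \<times> 'n \<Rightarrow>\<^sub>0 int) set" where
  "tensor_relations R M N =
     {frag_of (x \<oplus>\<^bsub>M\<^esub> x', y) - frag_of (x, y) - frag_of (x', y) | x x' y.
        x \<in> carrier M \<and> x' \<in> carrier M \<and> y \<in> carrier N} \<union>
     {frag_of (x, y \<oplus>\<^bsub>N\<^esub> y') - frag_of (x, y) - frag_of (x, y') | x y y'.
        x \<in> carrier M \<and> y \<in> carrier N \<and> y' \<in> carrier N} \<union>
     {frag_of (r \<odot>\<^bsub>M\<^esub> x, y) - frag_of (x, r \<odot>\<^bsub>N\<^esub> y) | r x y.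
        r \<in> carrier R \<and> x \<in> carrier M \<and> y \<in> carrier N}"

definition tensor_null ::
    "'r ring \<Rightarrow> ('r, 'm) module \<Rightarrow> ('r, 'n) module \<Rightarrow> ('m \<times> 'n \<Rightarrow>\<^sub>0 int) set" where
  "tensor_null R M N = generate (tensor_free M N) (tensor_relations R M N)"

text \<open>
  The additive map \<open>x \<otimes> y \<mapsto> \<phi> x \<otimes> \<psi> y\<close> on cosets. Whenever this is well defined, all cosets
  in the union coincide.
\<close>

definition tensor_map ::
    "'r ring \<Rightarrow> ('r, 'm) module \<Rightarrow> ('r, 'n) module \<Rightarrow> ('m \<Rightarrow> 'm) \<Rightarrow> ('n \<Rightarrow> 'n) \<Rightarrow>
     ('m \<times> 'n \<Rightarrow>\<^sub>0 int) set \<Rightarrow> ('m \<times> 'n \<Rightarrow>\<^sub>0 int) set" where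
  "tensor_map R M N \<phi> \<psi> u =
     (\<Union>\<xi>\<in>u. tensor_null R M N #>\<^bsub>tensor_free M N\<^esub>
              frag_extend (\<lambda>(x, y). frag_of (\<phi> x, \<psi> y)) \<xi>)"

definition tensor_product ::
    "'r ring \<Rightarrow> ('r, 'm) module \<Rightarrow> ('r, 'n) module \<Rightarrow>
     ('r, ('m \<times> 'n \<Rightarrow>\<^sub>0 int) set) module" where
  "tensor_product R M N =
     (let Q = tensor_free M N Mod tensor_null R M N in
      \<lparr>carrier = carrier Q, monoid.mult = (\<lambda>_ _. undefined), one = undefined,
       ring.zero = \<one>\<^bsub>Q\<^esub>, add = monoid.mult Q,
       module.smult = (\<lambda>r. tensor_map R M N (\<lambda>x. r \<odot>\<^bsub>M\<^esub> x) (\<lambda>y. y))\<rparr>)"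

section \<open>The module of invariants and its rank\<close>

definition is_module_basis :: "'r ring \<Rightarrow> ('r, 'm) module \<Rightarrow> 'm set \<Rightarrow> bool" where
  "is_module_basis R M B \<longleftrightarrow>
     finite B \<and> B \<subseteq> carrier M \<and>
     (\<forall>x\<in>carrier M. \<exists>!c. c \<in> B \<rightarrow>\<^sub>E carrier R \<and> x = (\<Oplus>\<^bsub>M\<^esub>b\<in>B. c b \<odot>\<^bsub>M\<^esub> b))"

definition module_rank :: "'r ring \<Rightarrow> ('r, 'm) module \<Rightarrow> nat" where
  "module_rank R M = (THE n. \<exists>B. is_module_basis R M B \<and> card B = n)"

text \<open>\<open>F\<^sub>2[T]\<close> as a subring of \<open>C\<^sub>\<infinity>[T]\<close>.\<close>

definition F2T :: "'a::field poly ring" where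
  "F2T = ring_of_type_algebra \<lparr>carrier := {p. \<forall>k. Polynomial.coeff p k \<in> {0, 1}}\<rparr>"

definition motive_tate ::
    "('a::field \<Rightarrow> ereal) \<Rightarrow> 'a \<Rightarrow> 'a ^ 'n ^ 'n \<Rightarrow>
     ('a poly, (('a skew_poly ^ 'n::finite) \<times> 'a fps \<Rightarrow>\<^sub>0 int) set) module" where
  "motive_tate ord \<theta> A = tensor_product ring_of_type_algebra (motive \<theta> A) (tate ord)"

definition motive_tate_tau ::
    "('a::field \<Rightarrow> ereal) \<Rightarrow> 'a \<Rightarrow> 'a ^ 'n ^ 'n \<Rightarrow>
     (('a skew_poly ^ 'n::finite) \<times> 'a fps \<Rightarrow>\<^sub>0 int) set \<Rightarrow>
     (('a skew_poly ^ 'n) \<times> 'a fps \<Rightarrow>\<^sub>0 int) set" where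
  "motive_tate_tau ord \<theta> A =
     tensor_map ring_of_type_algebra (motive \<theta> A) (tate ord) motive_tau tate_tau"

definition H1 ::
    "('a::field \<Rightarrow> ereal) \<Rightarrow> 'a \<Rightarrow> 'a ^ 'n ^ 'n \<Rightarrow>
     ('a poly, (('a skew_poly ^ 'n::finite) \<times> 'a fps \<Rightarrow>\<^sub>0 int) set) module" where
  "H1 ord \<theta> A =
     (motive_tate ord \<theta> A)
       \<lparr>carrier := {u \<in> carrier (motive_tate ord \<theta> A). motive_tate_tau ord \<theta> A u = u}\<rparr>"

definition h1 :: "('a::field \<Rightarrow> ereal) \<Rightarrow> 'a \<Rightarrow> 'a ^ 'n ^ 'n::finite \<Rightarrow> nat" where
  "h1 ord \<theta> A = module_rank F2T (H1 ord \<theta> A)"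

end

theory Submission
  imports Defs
begin

text \<open>
  In the basis \<open>e\<^sub>j, \<tau> e\<^sub>j\<close> of the motive, a \<open>\<tau>\<close>-invariant element is given by a vector
  \<open>Y = \<Sum> y\<^sub>n T\<^sup>n\<close> of convergent power series with
  \<open>\<theta>\<^sup>2 y\<^sub>n\<^sup>4 + A\<^sup>t y\<^sub>n\<^sup>2 + y\<^sub>n = y\<^sub>n\<^sub>-\<^sub>1\<^sup>4\<close> (powers taken entrywise). Write \<open>y\<^sub>n = (x, z)\<close>. Eliminating \<open>z\<close>
  leaves an equation of degree 16 for \<open>x\<close>, and the hypotheses on \<open>v\<close> and \<open>t\<close> determine its Newton polygon.
  Reading off valuations, the first nonzero \<open>y\<^sub>n\<close> satisfies \<open>ord z \<le> (4 - 2v)/7\<close>, together with two further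
  inequalities, and these are inherited by all later \<open>y\<^sub>n\<close>. As \<open>(4 - 2v)/7 \<le> 0\<close>, the \<open>y\<^sub>n\<close> do not tend to \<open>0\<close>.
\<close>

no_notation fps_nth (infixl "$" 75)

subsection \<open>Characteristic two\<close>

lemma char2_add_self:
  assumes "CHAR('a::ring_1) = 2"
  shows "x + x = (0::'a)"
  using of_nat_CHAR[where 'a='a] assms by (metis mult_2 mult_zero_left of_nat_numeral)

lemma char2_uminus: "CHAR('a::ring_1) = 2 \<Longrightarrow> - x = (x::'a)"
  using char2_add_self[of x] by (simp add: minus_unique)

lemma char2_square_add:
  assumes "CHAR('a::comm_ring_1) = 2"
  shows "(x + y) ^ 2 = x ^ 2 + (y::'a) ^ 2"
proof -
  have "(x + y) ^ 2 = x ^ 2 + y ^ 2 + (x * y + x * y)"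
    unfolding power2_eq_square by (simp only: algebra_simps)
  then show ?thesis by (simp only: char2_add_self[OF assms] add_0_right)
qed

lemma char2_square_sum:
  assumes "CHAR('a::comm_ring_1) = 2"
  shows "(\<Sum>i\<in>I. f i :: 'a) ^ 2 = (\<Sum>i\<in>I. f i ^ 2)"
  by (induction I rule: infinite_finite_induct) (simp_all add: char2_square_add[OF assms])

lemma char2_power_add:
  assumes "CHAR('a::comm_ring_1) = 2"
  shows "(x + y) ^ (2 ^ n) = x ^ (2 ^ n) + (y::'a) ^ (2 ^ n)"
  by (induction n) (simp_all add: power_mult char2_square_add[OF assms] mult.commute[of 2])

subsection \<open>Twisted polynomials\<close>

lemma sum_coeff_degree_le:
  assumes "Polynomial.degree p \<le> N" "\<And>k. g k 0 = 0"
  shows "(\<Sum>k\<le>Polynomial.degree p. g k (Polynomial.coeff p k)) = (\<Sum>k\<le>N. g k (Polynomial.coeff p k) :: 'b::comm_monoid_add)"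
  using assms by (intro sum.mono_neutral_left) (auto simp: coeff_eq_0)

text \<open>The degree of \<open>p + q\<close> can drop below those of \<open>p\<close> and
  \<open>q\<close>, so all three sums are first extended to a common bound; \<open>g k 0 = 0\<close>
  makes the extra terms vanish.\<close>

lemma sum_coeff_add:
  assumes "\<And>k. g k 0 = 0" "\<And>k a b. g k (a + b) = g k a + g k b"
  shows "(\<Sum>k\<le>Polynomial.degree (p + q). g k (Polynomial.coeff (p + q) k)) =
    (\<Sum>k\<le>Polynomial.degree p. g k (Polynomial.coeff p k)) +
    (\<Sum>k\<le>Polynomial.degree q. g k (Polynomial.coeff q k) :: 'b::comm_monoid_add)"
proof -
  define N where "N = max (Polynomial.degree p) (Polynomial.degree q)"
  have "Polynomial.degree (p + q) \<le> N" "Polynomial.degree p \<le> N" "Polynomial.degree q \<le> N"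
    unfolding N_def by (simp_all add: degree_add_le_max)
  note le = this[THEN sum_coeff_degree_le[where g=g, OF _ assms(1)]]
  show ?thesis unfolding le by (simp add: assms(2) sum.distrib)
qed

lemma sum_coeff_monom:
  assumes "\<And>k. g k 0 = 0"
  shows "(\<Sum>k\<le>Polynomial.degree (Polynomial.monom a n). g k (Polynomial.coeff (Polynomial.monom a n) k))
    = (g n a :: 'b::comm_monoid_add)"
proof -
  have "(\<Sum>k\<le>Polynomial.degree (Polynomial.monom a n). g k (Polynomial.coeff (Polynomial.monom a n) k))
      = (\<Sum>k\<le>n. g k (Polynomial.coeff (Polynomial.monom a n) k))"
    by (rule sum_coeff_degree_le) (simp_all add: degree_monom_le assms)
  also have "\<dots> = (\<Sum>k\<le>n. if k = n then g n a else 0)"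
    by (intro sum.cong) (auto simp: assms)
  finally show ?thesis by simp
qed

lemma skew_mult_0_right [simp]: "skew_mult p 0 = 0"
  by (simp add: skew_mult_def zero_power)

text \<open>The exponents \<open>2 ^ i\<close> fall on the right factor, so this is additivity of
  the iterated Frobenius map.\<close>

lemma skew_mult_add_right:
  assumes "CHAR('a::field) = 2"
  shows "skew_mult p (q + r) = skew_mult p q + skew_mult p (r :: 'a poly)"
  unfolding skew_mult_def
  by (subst sum_coeff_add)
    (simp_all add: char2_power_add[OF assms] distrib_left sum.distrib flip: add_monom)

lemma skew_mult_monom:
  "skew_mult (Polynomial.monom a i) (Polynomial.monom b j) = Polynomial.monom (a * b ^ (2 ^ i)) (i + j)"
  unfolding skew_mult_def
  by (subst sum_coeff_monom[where g="\<lambda>i a. \<Sum>j\<le>_. Polynomial.monom (a * _ j ^ 2 ^ i) (i + j)"], simp)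
    (subst sum_coeff_monom, simp_all)

lemma skew_act_add_right:
  assumes "CHAR('a::field) = 2"
  shows "skew_act p (m + m') = skew_act p m + skew_act p (m' :: 'a poly ^ 'n)"
  by (simp add: skew_act_def vec_eq_iff skew_mult_add_right[OF assms])

lemma skew_act_0_right [simp]: "skew_act p 0 = 0"
  by (simp add: skew_act_def vec_eq_iff)

lemma skew_act_sum_right:
  assumes "CHAR('a::field) = 2"
  shows "skew_act p (\<Sum>i\<in>I. f i) = (\<Sum>i\<in>I. skew_act p (f i :: 'a poly ^ 'n))"
  by (induction I rule: infinite_finite_induct) (simp_all add: skew_act_add_right[OF assms])

lemma skew_act_monom_axis:
  "skew_act (Polynomial.monom a i) (axis j (Polynomial.monom b n))
     = axis j (Polynomial.monom (a * b ^ (2 ^ i)) (i + n))"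
  by (simp add: skew_act_def vec_eq_iff axis_def skew_mult_monom)

lemma sum_axis: "(\<Sum>j\<in>UNIV. axis j (f j)) = (\<chi> j. (f j :: 'a::comm_monoid_add))"
  by (simp add: vec_eq_iff axis_def)

subsection \<open>Power series\<close>

lemma tate_tau_nth [simp]: "fps_nth (tate_tau f) n = fps_nth f n ^ 2"
  by (simp add: tate_tau_def)

lemma tate_tau_0 [simp]: "tate_tau 0 = 0"
  by (simp add: fps_eq_iff)

lemma tate_tau_1 [simp]: "tate_tau 1 = 1"
  by (simp add: fps_eq_iff)

lemma tate_tau_const [simp]: "tate_tau (fps_const a) = fps_const (a ^ 2)"
  by (simp add: fps_eq_iff)

lemma tate_tau_X [simp]: "tate_tau fps_X = fps_X"
  by (simp add: fps_eq_iff fps_X_def)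

lemma tate_tau_add:
  assumes "CHAR('a::field) = 2"
  shows "tate_tau (f + g) = tate_tau f + tate_tau (g :: 'a fps)"
  by (simp add: fps_eq_iff char2_square_add[OF assms])

lemma tate_tau_mult:
  assumes "CHAR('a::field) = 2"
  shows "tate_tau (f * g) = tate_tau f * tate_tau (g :: 'a fps)"
  by (simp add: fps_eq_iff fps_mult_nth char2_square_sum[OF assms] power_mult_distrib)

subsection \<open>Coordinates with respect to the basis of \<open>e\<^sub>j\<close> and \<open>\<tau> e\<^sub>j\<close>\<close>

definition pair_scale :: "'b::comm_ring_1 \<Rightarrow> ('b ^ 'n) \<times> ('b ^ 'n) \<Rightarrow> ('b ^ 'n) \<times> ('b ^ 'n)" where
  "pair_scale f w = (f *s fst w, f *s snd w)"

lemma pair_scale_simps [simp]: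
  "pair_scale 0 w = 0" "pair_scale f 0 = 0" "pair_scale 1 w = w"
  "pair_scale f (pair_scale g w) = pair_scale (f * g) w"
  by (simp_all add: pair_scale_def vec_eq_iff zero_prod_def mult.assoc)

lemma pair_scale_add_left: "pair_scale (f + g) w = pair_scale f w + pair_scale g w"
  by (simp add: pair_scale_def vec_eq_iff plus_prod_def distrib_right)

lemma pair_scale_add_right: "pair_scale f (w + w') = pair_scale f w + pair_scale f w'"
  by (simp add: pair_scale_def vec_eq_iff plus_prod_def distrib_left)

lemma pair_scale_sum_right: "pair_scale f (\<Sum>i\<in>I. w i) = (\<Sum>i\<in>I. pair_scale f (w i))"
  by (induction I rule: infinite_finite_induct) (simp_all add: pair_scale_add_right)

lemma pair_scale_sum_left: "pair_scale (\<Sum>i\<in>I. f i) w = (\<Sum>i\<in>I. pair_scale (f i) w)"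
  by (induction I rule: infinite_finite_induct) (simp_all add: pair_scale_add_left)

text \<open>A pair \<open>(X, Y)\<close> stands for \<open>\<Sum>\<^sub>i X\<^sub>i e\<^sub>i + Y\<^sub>i \<tau> e\<^sub>i\<close>. The formula for \<open>\<tau>\<close> comes from
  \<open>\<tau>\<^sup>2 e\<^sub>i = (T - \<theta>) e\<^sub>i - \<Sum>\<^sub>j A\<^sub>i\<^sub>j \<tau> e\<^sub>j\<close>.\<close>

definition tau_coord ::
    "'a::field \<Rightarrow> 'a ^ 'n ^ 'n \<Rightarrow> ('a fps ^ 'n::finite) \<times> ('a fps ^ 'n) \<Rightarrow> ('a fps ^ 'n) \<times> ('a fps ^ 'n)" where
  "tau_coord \<theta> A w =
     ((\<chi> i. (fps_X - fps_const \<theta>) * tate_tau (snd w $ i)),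
      (\<chi> i. tate_tau (fst w $ i) - (\<Sum>j\<in>UNIV. fps_const (A $ j $ i) * tate_tau (snd w $ j))))"

text \<open>If \<open>E\<close> holds the coordinates of a vector e, the value is the coordinate
  vector of p e, since \<open>\<tau>\<close> acts on coordinates through
  \<open>tau_coord\<close>.\<close>

definition poly_coord ::
    "'a::field \<Rightarrow> 'a ^ 'n ^ 'n \<Rightarrow> ('a fps ^ 'n::finite) \<times> ('a fps ^ 'n) \<Rightarrow> 'a skew_poly \<Rightarrow> ('a fps ^ 'n) \<times> ('a fps ^ 'n)" where
  "poly_coord \<theta> A E p =
     (\<Sum>k\<le>Polynomial.degree p. pair_scale (fps_const (Polynomial.coeff p k)) ((tau_coord \<theta> A ^^ k) E))"

text \<open>The full power series ring contains both the polynomials in T and the convergent series,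
  so one target serves before and after tensoring.\<close>

definition motive_coord ::
    "'a::field \<Rightarrow> 'a ^ 'n ^ 'n \<Rightarrow> 'a skew_poly ^ 'n::finite \<Rightarrow> ('a fps ^ 'n) \<times> ('a fps ^ 'n)" where
  "motive_coord \<theta> A m = (\<Sum>j\<in>UNIV. poly_coord \<theta> A (axis j 1, 0) (m $ j))"

locale char2_motive =
  fixes \<theta> :: "'a::field" and A :: "'a ^ 'n ^ 'n::finite"
  assumes char2: "CHAR('a) = 2"
begin

abbreviation "L \<equiv> tau_coord \<theta> A"
abbreviation "coord \<equiv> motive_coord \<theta> A"

lemma tau_coord_add: "L (w + w') = L w + L w'"
  by (simp add: tau_coord_def plus_prod_def vec_eq_iff tate_tau_add[OF char2] algebra_simps sum.distrib)

lemma tau_coord_0 [simp]: "L 0 = 0"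
  by (simp add: tau_coord_def zero_prod_def vec_eq_iff)

lemma tau_coord_sum: "L (\<Sum>i\<in>I. w i) = (\<Sum>i\<in>I. L (w i))"
  by (induction I rule: infinite_finite_induct) (simp_all add: tau_coord_add)

lemma tau_coord_scale: "L (pair_scale f w) = pair_scale (tate_tau f) (L w)"
  by (simp add: tau_coord_def pair_scale_def vec_eq_iff tate_tau_mult[OF char2] algebra_simps
      sum_distrib_left)

lemma tau_coord_power_scale_const:
  "(L ^^ k) (pair_scale (fps_const a) w) = pair_scale (fps_const (a ^ 2 ^ k)) ((L ^^ k) w)"
  by (induction k) (simp_all add: tau_coord_scale mult.commute[of 2] flip: power_mult)

lemma tau_coord_power_scale_X:
  "(L ^^ k) (pair_scale fps_X w) = pair_scale fps_X ((L ^^ k) w)"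
  by (induction k) (simp_all add: tau_coord_scale)

lemma tau_coord_power_sum: "(L ^^ k) (\<Sum>i\<in>I. w i) = (\<Sum>i\<in>I. (L ^^ k) (w i))"
  by (induction k) (simp_all add: tau_coord_sum)

lemma poly_coord_add: "poly_coord \<theta> A E (p + q) = poly_coord \<theta> A E p + poly_coord \<theta> A E q"
  unfolding poly_coord_def
  by (rule sum_coeff_add[where g="\<lambda>k a. pair_scale (fps_const a) ((L ^^ k) E)"])
    (simp_all add: pair_scale_add_left flip: fps_const_add)

lemma poly_coord_0 [simp]: "poly_coord \<theta> A E 0 = 0"
  by (simp add: poly_coord_def)

lemma poly_coord_sum: "poly_coord \<theta> A E (\<Sum>i\<in>I. p i) = (\<Sum>i\<in>I. poly_coord \<theta> A E (p i))"
  by (induction I rule: infinite_finite_induct) (simp_all add: poly_coord_add)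

lemma poly_coord_monom:
  "poly_coord \<theta> A E (Polynomial.monom a n) = pair_scale (fps_const a) ((L ^^ n) E)"
  unfolding poly_coord_def
  by (rule sum_coeff_monom[where g="\<lambda>k a. pair_scale (fps_const a) ((L ^^ k) E)"]) simp

text \<open>Moving the constant \<open>coeff q j\<close> past \<open>L ^^ k\<close> raises it to the
  power \<open>2 ^ k\<close>, which is the twist in \<open>skew_mult\<close>.\<close>

lemma poly_coord_skew_mult:
  "poly_coord \<theta> A E (skew_mult p q) =
     (\<Sum>k\<le>Polynomial.degree p. pair_scale (fps_const (Polynomial.coeff p k)) ((L ^^ k) (poly_coord \<theta> A E q)))"
proof -
  have "(L ^^ k) (poly_coord \<theta> A E q) =
      (\<Sum>j\<le>Polynomial.degree q. pair_scale (fps_const (Polynomial.coeff q j ^ 2 ^ k)) ((L ^^ (k + j)) E))" for k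
    unfolding poly_coord_def by (simp add: tau_coord_power_sum tau_coord_power_scale_const funpow_add)
  then show ?thesis
    unfolding skew_mult_def by (simp add: poly_coord_sum poly_coord_monom pair_scale_sum_right)
qed

lemma coord_add: "coord (m + m') = coord m + coord m'"
  by (simp add: motive_coord_def poly_coord_add sum.distrib)

lemma coord_0 [simp]: "coord 0 = 0"
  by (simp add: motive_coord_def)

lemma coord_sum: "coord (\<Sum>i\<in>I. m i) = (\<Sum>i\<in>I. coord (m i))"
  by (induction I rule: infinite_finite_induct) (simp_all add: coord_add)

lemma coord_skew_act:
  "coord (skew_act p m) =
     (\<Sum>k\<le>Polynomial.degree p. pair_scale (fps_const (Polynomial.coeff p k)) ((L ^^ k) (coord m)))"
  unfolding motive_coord_def skew_act_def
  by (simp add: poly_coord_skew_mult tau_coord_power_sum pair_scale_sum_right)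
    (rule sum.swap)

lemma coord_scale: "coord (skew_act [:a:] m) = pair_scale (fps_const a) (coord m)"
  by (simp add: coord_skew_act)

lemma coord_motive_tau: "coord (motive_tau m) = L (coord m)"
  by (simp add: motive_tau_def coord_skew_act)

lemma coord_axis: "coord (axis j p) = poly_coord \<theta> A (axis j 1, 0) p"
proof -
  have "coord (axis j p) = (\<Sum>i\<in>UNIV. if i = j then poly_coord \<theta> A (axis j 1, 0) p else 0)"
    unfolding motive_coord_def by (intro sum.cong) (auto simp: axis_def)
  then show ?thesis by simp
qed

lemma coord_basis: "coord (motive_basis i) = (axis i 1, 0)"
  using poly_coord_monom[of "(axis i 1, 0)" 1 0]
  by (simp add: motive_basis_def coord_axis)

lemma coord_tau_basis: "L (axis i 1, 0) = (0, axis i 1)"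
  by (simp add: tau_coord_def vec_eq_iff axis_def)

text \<open>The terms in \<open>\<theta>\<close> and \<open>A\<close> cancel against those that
  \<open>tau_coord\<close> produces for \<open>\<tau>\<close> applied twice to the basis vector;
  only T times the basis vector remains.\<close>

lemma coord_T_basis: "coord (motive_T \<theta> A (motive_basis i)) = pair_scale fps_X (axis i 1, 0)"
proof -
  have "(\<Sum>j\<in>UNIV. pair_scale (fps_const (A $ i $ j)) (0, axis j 1)) = (0, \<chi> j. fps_const (A $ i $ j))"
    by (simp add: pair_scale_def vec_eq_iff axis_def prod_eq_iff fst_sum snd_sum if_distrib cong: if_cong)
  moreover have "L (0, axis i 1) = ((fps_X - fps_const \<theta>) *s axis i 1, - (\<chi> j. fps_const (A $ i $ j)))"
    by (auto simp: tau_coord_def vec_eq_iff axis_def if_distrib[where f=tate_tau]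
        if_distrib[where f="\<lambda>x. _ * x"] cong: if_cong)
  ultimately show ?thesis
    by (simp add: motive_T_basis coord_add coord_sum coord_scale coord_motive_tau coord_basis
        coord_tau_basis plus_prod_def vec_eq_iff)
      (simp add: pair_scale_def vec_eq_iff algebra_simps)
qed

text \<open>Frobenius fixes T, so multiplication by \<open>fps_X\<close> commutes with
  \<open>L\<close> and with constants; the claim spreads from the basis to all of the
  motive.\<close>

lemma coord_T: "coord (motive_T \<theta> A m) = pair_scale fps_X (coord m)"
proof -
  have "motive_T \<theta> A m = (\<Sum>i\<in>UNIV. skew_act (m $ i) (motive_T \<theta> A (motive_basis i)))"
    by (simp only: motive_T_def[of _ _ m] motive_T_basis)
  then have "coord (motive_T \<theta> A m) =
      (\<Sum>i\<in>UNIV. \<Sum>k\<le>Polynomial.degree (m $ i).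
        pair_scale fps_X (pair_scale (fps_const (Polynomial.coeff (m $ i) k)) ((L ^^ k) (axis i 1, 0))))"
    by (simp add: coord_sum coord_skew_act coord_T_basis tau_coord_power_scale_X mult.commute)
  then show ?thesis
    by (simp add: motive_coord_def poly_coord_def pair_scale_sum_right)
qed

lemma coord_T_power: "coord ((motive_T \<theta> A ^^ k) m) = pair_scale (fps_X ^ k) (coord m)"
  by (induction k) (simp_all add: coord_T)

lemma coord_smult: "coord (p \<odot>\<^bsub>motive \<theta> A\<^esub> m) = pair_scale (fps_of_poly p) (coord m)"
proof -
  have "fps_of_poly p = fps_of_poly (\<Sum>k\<le>Polynomial.degree p. Polynomial.monom (Polynomial.coeff p k) k)"
    by (simp add: poly_as_sum_of_monoms)
  also have "\<dots> = (\<Sum>k\<le>Polynomial.degree p. fps_const (Polynomial.coeff p k) * fps_X ^ k)"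
    by (simp add: fps_of_poly_sum fps_of_poly_monom)
  finally show ?thesis
    by (simp add: motive_def coord_sum coord_scale coord_T_power pair_scale_sum_left)
qed

end

subsection \<open>Tensor products\<close>

text \<open>The only possible nonempty basis is the singleton of zero, and there the distinct
  scalars \<open>r\<close> and \<open>s\<close> give two expansions of zero. Hence the empty basis
  is the only one and \<open>THE\<close> yields 0.\<close>

lemma module_rank_trivial:
  assumes carrier: "carrier M = {\<zero>\<^bsub>M\<^esub>}" and add: "\<zero>\<^bsub>M\<^esub> \<oplus>\<^bsub>M\<^esub> \<zero>\<^bsub>M\<^esub> = \<zero>\<^bsub>M\<^esub>"
    and rs: "r \<in> carrier R" "s \<in> carrier R" "r \<noteq> s"
    and smult: "r \<odot>\<^bsub>M\<^esub> \<zero>\<^bsub>M\<^esub> = \<zero>\<^bsub>M\<^esub>" "s \<odot>\<^bsub>M\<^esub> \<zero>\<^bsub>M\<^esub> = \<zero>\<^bsub>M\<^esub>"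
  shows "module_rank R M = 0"
proof -
  interpret abelian_monoid M
    by (rule abelian_monoidI) (auto simp: carrier add)
  have empty: "is_module_basis R M {}"
    by (auto simp: is_module_basis_def carrier)
  have "B = {}" if "is_module_basis R M B" for B
  proof (rule ccontr)
    assume "B \<noteq> {}"
    with that carrier have B: "B = {\<zero>\<^bsub>M\<^esub>}"
      by (auto simp: is_module_basis_def)
    have unique: "\<exists>!c. c \<in> B \<rightarrow>\<^sub>E carrier R \<and> \<zero>\<^bsub>M\<^esub> = (\<Oplus>\<^bsub>M\<^esub>b\<in>B. c b \<odot>\<^bsub>M\<^esub> b)"
      using that by (simp add: is_module_basis_def)
    have sum: "\<zero>\<^bsub>M\<^esub> = (\<Oplus>\<^bsub>M\<^esub>b\<in>B. (\<lambda>b\<in>B. q) b \<odot>\<^bsub>M\<^esub> b)" if "q \<odot>\<^bsub>M\<^esub> \<zero>\<^bsub>M\<^esub> = \<zero>\<^bsub>M\<^esub>" for q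
    proof -
      have "(\<Oplus>\<^bsub>M\<^esub>b\<in>B. (\<lambda>b\<in>B. q) b \<odot>\<^bsub>M\<^esub> b) \<in> carrier M"
        by (rule finsum_closed) (auto simp: B that)
      then show ?thesis by (simp add: carrier)
    qed
    have "(\<lambda>b\<in>B. q) \<in> B \<rightarrow>\<^sub>E carrier R" if "q \<in> carrier R" for q
      using that by simp
    with unique sum[OF smult(1)] sum[OF smult(2)] rs(1,2) have "(\<lambda>b\<in>B. r) = (\<lambda>b\<in>B. s)"
      by blast
    then have "(\<lambda>b\<in>B. r) \<zero>\<^bsub>M\<^esub> = (\<lambda>b\<in>B. s) \<zero>\<^bsub>M\<^esub>" by simp
    with rs(3) show False by (simp add: B)
  qed
  with empty show ?thesis
    unfolding module_rank_def by (intro the_equality) (metis card.empty)+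
qed

text \<open>The universal property of the free abelian group concerns group records, so the additive
  group \<open>'b\<close> is first packaged as one.\<close>

lemma frag_lift_exists:
  fixes g :: "'c \<Rightarrow> 'b::ab_group_add"
  shows "\<exists>h. (\<forall>a b. h (a + b) = h a + h b) \<and> (\<forall>x. h (frag_of x) = g x)"
proof -
  define G :: "'b monoid" where "G = \<lparr>carrier = UNIV, monoid.mult = (+), one = 0\<rparr>"
  have "comm_group G"
  proof (rule comm_groupI)
    show "\<exists>y\<in>carrier G. y \<otimes>\<^bsub>G\<^esub> x = \<one>\<^bsub>G\<^esub>" for x
      by (rule bexI[of _ "- x"]) (simp_all add: G_def)
  qed (simp_all add: G_def ac_simps)
  then obtain h where h: "h \<in> hom (free_Abelian_group UNIV) G" "\<And>x. h (frag_of x) = g x"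
    using comm_group.free_Abelian_group_universal[of G g UNIV] by (auto simp: G_def)
  then have "h (a + b) = h a + h b" for a b
    using hom_mult[OF h(1), of a b] by (simp add: G_def)
  with h(2) show ?thesis by blast
qed

locale tensor =
  fixes R :: "'r ring" and M :: "('r, 'm) module" and N :: "('r, 'n) module"
  assumes add_closed_left: "x \<in> carrier M \<Longrightarrow> x' \<in> carrier M \<Longrightarrow> x \<oplus>\<^bsub>M\<^esub> x' \<in> carrier M"
    and add_closed_right: "y \<in> carrier N \<Longrightarrow> y' \<in> carrier N \<Longrightarrow> y \<oplus>\<^bsub>N\<^esub> y' \<in> carrier N"
    and smult_closed_left: "r \<in> carrier R \<Longrightarrow> x \<in> carrier M \<Longrightarrow> r \<odot>\<^bsub>M\<^esub> x \<in> carrier M"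
    and smult_closed_right: "r \<in> carrier R \<Longrightarrow> y \<in> carrier N \<Longrightarrow> r \<odot>\<^bsub>N\<^esub> y \<in> carrier N"
begin

abbreviation "F \<equiv> tensor_free M N"
abbreviation "Null \<equiv> tensor_null R M N"

lemma tensor_free_simps [simp]:
  "x \<otimes>\<^bsub>F\<^esub> y = x + y" "\<one>\<^bsub>F\<^esub> = 0"
  "x \<in> carrier F \<longleftrightarrow> Poly_Mapping.keys x \<subseteq> carrier M \<times> carrier N"
  "x \<in> carrier F \<Longrightarrow> inv\<^bsub>F\<^esub> x = - x"
  by (simp_all add: tensor_free_def)

lemma comm_group_F: "comm_group F"
  unfolding tensor_free_def by (rule abelian_free_Abelian_group)

lemma group_F: "group F"
  using comm_group_F by (rule comm_group.axioms)

lemma frag_of_in_F: "x \<in> carrier M \<Longrightarrow> y \<in> carrier N \<Longrightarrow> frag_of (x, y) \<in> carrier F"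
  by simp

lemma diff_in_F: "\<xi> \<in> carrier F \<Longrightarrow> \<eta> \<in> carrier F \<Longrightarrow> \<xi> - \<eta> \<in> carrier F"
  using keys_diff[of \<xi> \<eta>] by auto

lemma relations_in_F: "tensor_relations R M N \<subseteq> carrier F"
proof -
  have diff: "\<xi> - \<eta> \<in> carrier F" if "\<xi> \<in> carrier F" "\<eta> \<in> carrier F" for \<xi> \<eta>
    using that by (rule diff_in_F)
  show ?thesis
    unfolding tensor_relations_def
    by (auto intro!: diff frag_of_in_F add_closed_left add_closed_right smult_closed_left
        smult_closed_right simp del: tensor_free_simps(3))
qed

lemma subgroup_Null: "subgroup Null F"
  unfolding tensor_null_def by (rule group.generate_is_subgroup[OF group_F relations_in_F])

lemma Null_in_F: "\<xi> \<in> Null \<Longrightarrow> \<xi> \<in> carrier F"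
  using subgroup.mem_carrier[OF subgroup_Null] .

lemma Null_0: "0 \<in> Null"
  using subgroup.one_closed[OF subgroup_Null] by simp

lemma Null_add: "\<xi> \<in> Null \<Longrightarrow> \<eta> \<in> Null \<Longrightarrow> \<xi> + \<eta> \<in> Null"
  using subgroup.m_closed[OF subgroup_Null, of \<xi> \<eta>] by simp

lemma Null_uminus: "\<xi> \<in> Null \<Longrightarrow> - \<xi> \<in> Null"
  using subgroup.m_inv_closed[OF subgroup_Null, of \<xi>] tensor_free_simps(4)[OF Null_in_F, of \<xi>] by metis

lemma Null_diff: "\<xi> \<in> Null \<Longrightarrow> \<eta> \<in> Null \<Longrightarrow> \<xi> - \<eta> \<in> Null"
  using Null_add[OF _ Null_uminus, of \<xi> \<eta>] by simp

lemma Null_sum: "(\<And>i. i \<in> I \<Longrightarrow> f i \<in> Null) \<Longrightarrow> sum f I \<in> Null"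
  by (induction I rule: infinite_finite_induct) (auto intro: Null_0 Null_add)

lemma relation_in_Null: "\<xi> \<in> tensor_relations R M N \<Longrightarrow> \<xi> \<in> Null"
  unfolding tensor_null_def by (rule generate.incl)

lemma Null_left_add:
  "x \<in> carrier M \<Longrightarrow> x' \<in> carrier M \<Longrightarrow> y \<in> carrier N \<Longrightarrow>
    frag_of (x \<oplus>\<^bsub>M\<^esub> x', y) - frag_of (x, y) - frag_of (x', y) \<in> Null"
  by (rule relation_in_Null) (unfold tensor_relations_def, blast)

lemma Null_right_add:
  "x \<in> carrier M \<Longrightarrow> y \<in> carrier N \<Longrightarrow> y' \<in> carrier N \<Longrightarrow>
    frag_of (x, y \<oplus>\<^bsub>N\<^esub> y') - frag_of (x, y) - frag_of (x, y') \<in> Null"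
  by (rule relation_in_Null) (unfold tensor_relations_def, blast)

lemma Null_smult:
  "r \<in> carrier R \<Longrightarrow> x \<in> carrier M \<Longrightarrow> y \<in> carrier N \<Longrightarrow>
    frag_of (r \<odot>\<^bsub>M\<^esub> x, y) - frag_of (x, r \<odot>\<^bsub>N\<^esub> y) \<in> Null"
  by (rule relation_in_Null) (unfold tensor_relations_def, blast)

text \<open>This is the step by which an additive map on formal sums descends to the tensor
  product.\<close>

lemma additive_zero_on_Null:
  fixes h :: "('m \<times> 'n \<Rightarrow>\<^sub>0 int) \<Rightarrow> 'b::ab_group_add"
  assumes add: "\<And>a b. h (a + b) = h a + h b"
    and rel: "\<And>\<xi>. \<xi> \<in> tensor_relations R M N \<Longrightarrow> h \<xi> = 0"
    and "\<xi> \<in> Null"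
  shows "h \<xi> = 0"
proof -
  have h0: "h 0 = 0" using add[of 0 0] by simp
  show ?thesis
    using assms(3) unfolding tensor_null_def
  proof (induction rule: generate.induct)
    case (inv \<eta>)
    then have "inv\<^bsub>F\<^esub> \<eta> = - \<eta>" using relations_in_F by (intro tensor_free_simps(4)) blast
    with add[of \<eta> "- \<eta>"] rel[OF inv] h0 show ?case by simp
  qed (simp_all add: h0 rel add)
qed

lemma mem_coset_iff: "\<eta> \<in> Null #>\<^bsub>F\<^esub> \<xi> \<longleftrightarrow> \<eta> - \<xi> \<in> Null"
proof
  assume "\<eta> - \<xi> \<in> Null"
  then show "\<eta> \<in> Null #>\<^bsub>F\<^esub> \<xi>"
    unfolding r_coset_def by (intro UN_I[of "\<eta> - \<xi>"]) simp_all
qed (auto simp: r_coset_def)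

lemma coset_Null:
  assumes \<xi>: "\<xi> \<in> Null"
  shows "Null #>\<^bsub>F\<^esub> \<xi> = Null"
proof (intro equalityI subsetI)
  show "\<eta> \<in> Null" if "\<eta> \<in> Null #>\<^bsub>F\<^esub> \<xi>" for \<eta>
    using Null_add[OF that[unfolded mem_coset_iff] \<xi>] by simp
  show "\<eta> \<in> Null #>\<^bsub>F\<^esub> \<xi>" if "\<eta> \<in> Null" for \<eta>
    unfolding mem_coset_iff using that \<xi> by (rule Null_diff)
qed

lemma carrier_tensor_product:
  "carrier (tensor_product R M N) = {Null #>\<^bsub>F\<^esub> \<xi> | \<xi>. \<xi> \<in> carrier F}"
  by (auto simp: tensor_product_def FactGroup_def RCOSETS_def)

lemma zero_tensor_product: "\<zero>\<^bsub>tensor_product R M N\<^esub> = Null"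
  by (simp add: tensor_product_def FactGroup_def)

lemma add_zero_tensor_product:
  "Null \<oplus>\<^bsub>tensor_product R M N\<^esub> Null = Null"
  using group.subgroup_mult_id[OF group_F subgroup_Null]
  by (simp add: tensor_product_def FactGroup_def)

text \<open>The image of \<open>\<xi>\<close> lies in its own coset, which is one of those united in
  \<open>tensor_map\<close>.\<close>

lemma tensor_map_fixed:
  assumes "tensor_map R M N \<phi> \<psi> u = u" "\<xi> \<in> u"
  shows "frag_extend (\<lambda>(x, y). frag_of (\<phi> x, \<psi> y)) \<xi> \<in> u"
proof -
  have "frag_extend (\<lambda>(x, y). frag_of (\<phi> x, \<psi> y)) \<xi> \<in> tensor_map R M N \<phi> \<psi> u"
    unfolding tensor_map_def by (rule UN_I[OF assms(2)]) (simp add: mem_coset_iff Null_0)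
  with assms(1) show ?thesis by simp
qed

lemma tensor_map_Null:
  assumes "\<And>\<xi>. \<xi> \<in> Null \<Longrightarrow> frag_extend (\<lambda>(x, y). frag_of (\<phi> x, \<psi> y)) \<xi> \<in> Null"
  shows "tensor_map R M N \<phi> \<psi> Null = Null"
  unfolding tensor_map_def using Null_0 by (auto simp: coset_Null assms)

end

subsection \<open>Valuations\<close>

locale valued_field =
  fixes ord :: "'a::field \<Rightarrow> ereal"
  assumes valuation: "is_valuation ord"
begin

lemma ord_eq_PInf_iff: "ord x = \<infinity> \<longleftrightarrow> x = 0"
  and ord_neq_MInf: "ord x \<noteq> -\<infinity>"
  and ord_mult: "ord (x * y) = ord x + ord y"
  and ord_add: "min (ord x) (ord y) \<le> ord (x + y)"
  using valuation unfolding is_valuation_def by blast+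

lemma ord_0 [simp]: "ord 0 = \<infinity>"
  by (simp add: ord_eq_PInf_iff)

lemma ord_finite:
  assumes "x \<noteq> 0"
  obtains r where "ord x = ereal r"
  using assms ord_eq_PInf_iff ord_neq_MInf by (cases "ord x") auto

lemma ord_1 [simp]: "ord 1 = 0"
proof -
  obtain r where r: "ord 1 = ereal r"
    using ord_finite zero_neq_one by metis
  with ord_mult[of 1 1] have "ereal r = ereal (r + r)" by simp
  with r show ?thesis by (simp add: zero_ereal_def)
qed

lemma ord_uminus [simp]: "ord (- x) = ord x"
proof -
  obtain r where r: "ord (- 1) = ereal r"
    using ord_finite[of "- 1"] by auto
  with ord_mult[of "- 1" "- 1"] have "ord (-1) = 0" by (simp add: zero_ereal_def)
  with ord_mult[of "- 1" x] show ?thesis by simp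
qed

lemma ord_add_less: "r < ord x \<Longrightarrow> r < ord y \<Longrightarrow> r < ord (x + y)"
  using ord_add[of x y] by (auto simp: min_def split: if_splits)

lemma ord_add_le: "r \<le> ord x \<Longrightarrow> r \<le> ord y \<Longrightarrow> r \<le> ord (x + y)"
  using ord_add[of x y] by (auto simp: min_def split: if_splits)

text \<open>For the upper bound, write \<open>x\<close> as \<open>(x + y) + (- y)\<close>: if both
  summands had valuation above \<open>ord x\<close>, so would \<open>x\<close>.\<close>

lemma ord_add_dominant: "ord x < ord y \<Longrightarrow> ord (x + y) = ord x"
proof (rule antisym)
  assume less: "ord x < ord y"
  show "ord (x + y) \<le> ord x"
    using ord_add_less[of "ord x" "x + y" "- y"] less by (force simp: not_le[symmetric])
  show "ord x \<le> ord (x + y)"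
    using less by (intro ord_add_le) auto
qed

lemma ord_mult_real: "ord x = ereal r \<Longrightarrow> ord y = ereal s \<Longrightarrow> ord (x * y) = ereal (r + s)"
  by (simp add: ord_mult)

lemma ord_power_real: "ord x = ereal r \<Longrightarrow> ord (x ^ n) = ereal (n * r)"
  by (induction n) (auto simp: ord_mult algebra_simps zero_ereal_def)

lemma ord_divide_real:
  assumes "ord x = ereal r" "ord y = ereal s"
  shows "ord (x / y) = ereal (r - s)"
proof -
  have "y \<noteq> 0" using assms by auto
  then have "ord x = ord (x / y) + ord y" by (simp flip: ord_mult)
  with assms show ?thesis by (cases "ord (x / y)") auto
qed

lemmas ord_real = ord_mult_real ord_power_real ord_divide_real

lemma ord_power_cancel:
  assumes "ord (x ^ n) = ereal r" "n > 0"
  shows "ord x = ereal (r / n)"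
proof -
  have "x \<noteq> 0" using assms by (auto simp: power_0_left)
  then obtain s where s: "ord x = ereal s" by (rule ord_finite)
  with ord_power_real[OF s, of n] assms show ?thesis by (linarith | simp)+
qed

text \<open>Reads off the valuation of a five-term polynomial away from the breaks of its Newton
  polygon, where one term is strictly smallest.\<close>

lemma ord_dominant5:
  assumes "ord a = ereal r" "ereal r < ord b" "ereal r < ord c" "ereal r < ord d" "ereal r < ord e"
  shows "ord (a + b + c + d + e) = ereal r"
  using assms by (simp add: ord_add_dominant)

end

subsection \<open>Invariants\<close>

lemma tate_simps [simp]:
  "carrier (tate ord) = tate_carrier ord" "f \<oplus>\<^bsub>tate ord\<^esub> g = f + g"
  "p \<odot>\<^bsub>tate ord\<^esub> f = fps_of_poly p * f"
  by (simp_all add: tate_def)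

lemma motive_simps [simp]:
  "carrier (motive \<theta> A) = UNIV" "m \<oplus>\<^bsub>motive \<theta> A\<^esub> m' = m + m'"
  by (simp_all add: motive_def)

lemma motive_smult_const: "[:a:] \<odot>\<^bsub>motive \<theta> A\<^esub> m = skew_act [:a:] m"
  by (simp add: motive_def)

lemma motive_smult_T: "[:0, 1:] \<odot>\<^bsub>motive \<theta> A\<^esub> m = motive_T \<theta> A m"
  using skew_act_1_left[of "motive_T \<theta> A m"]
  by (simp add: motive_def skew_act_0_left one_pCons)

context valued_field
begin

lemma tate_carrier_0: "0 \<in> tate_carrier ord"
  by (simp add: tate_carrier_def)

lemma tate_carrier_iff:
  "f \<in> tate_carrier ord \<longleftrightarrow> (\<forall>B::real. eventually (\<lambda>n. ereal B < ord (fps_nth f n)) sequentially)"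
  by (simp add: tate_carrier_def tendsto_PInfty)

lemma tate_carrier_const_mult:
  assumes "f \<in> tate_carrier ord"
  shows "fps_const a * f \<in> tate_carrier ord"
proof (cases "a = 0")
  case False
  then obtain r where r: "ord a = ereal r" by (rule ord_finite)
  show ?thesis
    unfolding tate_carrier_iff
  proof
    fix B :: real
    have "eventually (\<lambda>n. ereal (B - r) < ord (fps_nth f n)) sequentially"
      using assms unfolding tate_carrier_iff by blast
    then show "eventually (\<lambda>n. ereal B < ord (fps_nth (fps_const a * f) n)) sequentially"
    proof eventually_elim
      case (elim n)
      then show ?case by (cases "ord (fps_nth f n)") (simp_all add: ord_mult r)
    qed
  qed
qed (simp add: tate_carrier_0)

lemma tate_carrier_add:
  assumes "f \<in> tate_carrier ord" "g \<in> tate_carrier ord"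
  shows "f + g \<in> tate_carrier ord"
  unfolding tate_carrier_iff
proof
  fix B :: real
  have "eventually (\<lambda>n. ereal B < ord (fps_nth f n)) sequentially"
    "eventually (\<lambda>n. ereal B < ord (fps_nth g n)) sequentially"
    using assms unfolding tate_carrier_iff by blast+
  then show "eventually (\<lambda>n. ereal B < ord (fps_nth (f + g) n)) sequentially"
    by eventually_elim (simp add: ord_add_less)
qed

lemma tate_carrier_uminus: "f \<in> tate_carrier ord \<Longrightarrow> - f \<in> tate_carrier ord"
  by (simp add: tate_carrier_def)

lemma tate_carrier_mult_X:
  assumes "f \<in> tate_carrier ord"
  shows "fps_X * f \<in> tate_carrier ord"
proof -
  have "(\<lambda>n. ord (fps_nth (fps_X * f) (Suc n))) \<longlonglongrightarrow> \<infinity>"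
    using assms by (simp add: tate_carrier_def)
  then show ?thesis
    unfolding tate_carrier_def mem_Collect_eq by (rule LIMSEQ_imp_Suc)
qed

lemma tate_carrier_poly_mult:
  assumes "f \<in> tate_carrier ord"
  shows "fps_of_poly p * f \<in> tate_carrier ord"
proof (induction p)
  case (pCons a p)
  have "fps_of_poly (pCons a p) * f = fps_const a * f + fps_X * (fps_of_poly p * f)"
    by (simp add: fps_of_poly_pCons algebra_simps)
  with pCons.IH assms show ?case
    by (simp add: tate_carrier_add tate_carrier_const_mult tate_carrier_mult_X)
qed (simp add: tate_carrier_0)

lemma tate_tau_in_carrier:
  assumes "f \<in> tate_carrier ord"
  shows "tate_tau f \<in> tate_carrier ord"
  unfolding tate_carrier_iff
proof
  fix B :: real
  \<comment> \<open>Squaring doubles the valuation, and doubling a number above \<open>B\<close>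
    keeps it above \<open>B\<close> only if \<open>B\<close> is not negative; hence the absolute
    value.\<close>
  have "eventually (\<lambda>n. ereal \<bar>B\<bar> < ord (fps_nth f n)) sequentially"
    using assms unfolding tate_carrier_iff by blast
  then show "eventually (\<lambda>n. ereal B < ord (fps_nth (tate_tau f) n)) sequentially"
  proof eventually_elim
    case (elim n)
    then show ?case by (cases "ord (fps_nth f n)") (simp_all add: power2_eq_square ord_mult)
  qed
qed

lemma tensor_motive_tate: "tensor ring_of_type_algebra (motive \<theta> A) (tate ord)"
  by unfold_locales (simp_all add: tate_carrier_add tate_carrier_poly_mult)

end

section \<open>Comparison of the tensor product with the coordinate space\<close>

locale anderson_motive = valued_field ord + char2_motive \<theta> A
  for ord :: "'a::field \<Rightarrow> ereal" and \<theta> :: 'a and A :: "'a ^ 'n ^ 'n::finite"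
begin

sublocale tensor ring_of_type_algebra "motive \<theta> A" "tate ord"
  by (rule tensor_motive_tate)

lemma ring_of_type_algebra_carrier [simp]: "p \<in> carrier ring_of_type_algebra"
  by (simp add: ring_of_type_algebra_def)

text \<open>The coordinate map, sending the tensor of m and f to f times the coordinates of m,
  defined on formal sums before passing to the quotient.\<close>

definition \<Phi> :: "(('a skew_poly ^ 'n) \<times> 'a fps \<Rightarrow>\<^sub>0 int) \<Rightarrow> ('a fps ^ 'n) \<times> ('a fps ^ 'n)" where
  "\<Phi> = (SOME h. (\<forall>a b. h (a + b) = h a + h b) \<and>
     (\<forall>x. h (frag_of x) = pair_scale (snd x) (motive_coord \<theta> A (fst x))))"

lemma \<Phi>_add: "\<Phi> (\<xi> + \<eta>) = \<Phi> \<xi> + \<Phi> \<eta>"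
  and \<Phi>_frag_of: "\<Phi> (frag_of (m, f)) = pair_scale f (motive_coord \<theta> A m)"
proof -
  have *: "(\<forall>a b. \<Phi> (a + b) = \<Phi> a + \<Phi> b) \<and>
     (\<forall>x. \<Phi> (frag_of x) = pair_scale (snd x) (motive_coord \<theta> A (fst x)))"
    unfolding \<Phi>_def
    by (rule someI_ex[OF frag_lift_exists[of "\<lambda>x. pair_scale (snd x) (motive_coord \<theta> A (fst x))"]])
  show "\<Phi> (\<xi> + \<eta>) = \<Phi> \<xi> + \<Phi> \<eta>" using * by blast
  show "\<Phi> (frag_of (m, f)) = pair_scale f (motive_coord \<theta> A m)"
    using conjunct2[OF *] by simp
qed

lemma \<Phi>_0 [simp]: "\<Phi> 0 = 0"
  using \<Phi>_add[of 0 0] by simp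

lemma \<Phi>_diff: "\<Phi> (\<xi> - \<eta>) = \<Phi> \<xi> - \<Phi> \<eta>"
  using \<Phi>_add[of "\<xi> - \<eta>" \<eta>] by (simp add: algebra_simps)

lemma \<Phi>_sum: "\<Phi> (\<Sum>i\<in>I. \<xi> i) = (\<Sum>i\<in>I. \<Phi> (\<xi> i))"
  by (induction I rule: infinite_finite_induct) (simp_all add: \<Phi>_add)

text \<open>The three kinds of relations vanish by additivity of \<open>coord\<close>, additivity of
  \<open>pair_scale\<close> in the series, and \<open>coord_smult\<close>.\<close>

lemma \<Phi>_Null:
  assumes "\<xi> \<in> Null"
  shows "\<Phi> \<xi> = 0"
proof (rule additive_zero_on_Null[OF \<Phi>_add _ assms])
  fix \<xi> assume "\<xi> \<in> tensor_relations ring_of_type_algebra (motive \<theta> A) (tate ord)"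
  then show "\<Phi> \<xi> = 0"
    unfolding tensor_relations_def
    by (auto simp: \<Phi>_diff \<Phi>_frag_of coord_add coord_smult pair_scale_add_left
        pair_scale_add_right mult.commute)
qed

text \<open>Both sides are additive in \<open>\<xi>\<close>, so comparison on generators suffices.
  It is applied to \<open>\<tau>\<close> and to multiplication by polynomials.\<close>

lemma \<Phi>_frag_extend:
  assumes add: "\<And>w w'. K (w + w') = K w + K w'"
    and eq: "\<And>m f. \<Phi> (frag_of (\<phi> m, \<psi> f)) = K (\<Phi> (frag_of (m, f)))"
  shows "\<Phi> (frag_extend (\<lambda>(x, y). frag_of (\<phi> x, \<psi> y)) \<xi>) = K (\<Phi> \<xi>)"
proof -
  have K0: "K 0 = 0" using add[of 0 0] by simp
  have Kdiff: "K (w - w') = K w - K w'" for w w'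
    using add[of "w - w'" w'] by (simp add: algebra_simps)
  have "Poly_Mapping.keys \<xi> \<subseteq> UNIV" by simp
  then show ?thesis
  proof (induction \<xi> rule: frag_induction)
    case (diff a b)
    then show ?case by (simp add: frag_extend_diff \<Phi>_diff Kdiff)
  qed (auto simp: K0 eq)
qed

lemma \<Phi>_tau:
  "\<Phi> (frag_extend (\<lambda>(x, y). frag_of (motive_tau x, tate_tau y)) \<xi>) = tau_coord \<theta> A (\<Phi> \<xi>)"
  by (rule \<Phi>_frag_extend)
    (simp_all add: tau_coord_add \<Phi>_frag_of coord_motive_tau tau_coord_scale)

lemma \<Phi>_smult:
  "\<Phi> (frag_extend (\<lambda>(x, y). frag_of (p \<odot>\<^bsub>motive \<theta> A\<^esub> x, y)) \<xi>) = pair_scale (fps_of_poly p) (\<Phi> \<xi>)"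
  by (rule \<Phi>_frag_extend)
    (simp_all add: pair_scale_add_right \<Phi>_frag_of coord_smult mult.commute)

section \<open>Normal forms: the tensors with the vectors \<open>e_j\<close> and
  \<open>\<tau> e_j\<close> generate\<close>

definition normal_form ::
    "('n \<Rightarrow> 'a fps) \<Rightarrow> ('n \<Rightarrow> 'a fps) \<Rightarrow> (('a skew_poly ^ 'n) \<times> 'a fps \<Rightarrow>\<^sub>0 int)" where
  "normal_form g h = (\<Sum>j\<in>UNIV. frag_of (axis j (Polynomial.monom 1 0), g j)
     + frag_of (axis j (Polynomial.monom 1 1), h j))"

text \<open>The vectors \<open>e_j\<close> and \<open>\<tau> e_j\<close> have the standard unit
  vectors as coordinates, so a normal form can be recovered from its image.\<close>

lemma \<Phi>_normal_form: "\<Phi> (normal_form g h) = (\<chi> j. g j, \<chi> j. h j)"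
proof -
  have "coord (axis j (Polynomial.monom 1 0)) = (axis j 1, 0)"
    "coord (axis j (Polynomial.monom 1 1)) = (0, axis j 1)" for j
    unfolding coord_axis poly_coord_monom by (simp_all add: coord_tau_basis)
  then have "\<Phi> (normal_form g h) = (\<Sum>j\<in>UNIV. pair_scale (g j) (axis j 1, 0) + pair_scale (h j) (0, axis j 1))"
    by (simp only: normal_form_def \<Phi>_sum \<Phi>_add \<Phi>_frag_of)
  also have "\<dots> = (\<chi> j. g j, \<chi> j. h j)"
    by (simp add: pair_scale_def prod_eq_iff fst_sum snd_sum vec_eq_iff axis_def if_distrib cong: if_cong)
  finally show ?thesis .
qed

definition tate_family :: "('n \<Rightarrow> 'a fps) \<Rightarrow> bool" where
  "tate_family g \<longleftrightarrow> (\<forall>j. g j \<in> tate_carrier ord)"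

text \<open>The additivity relation for 0 + 0 is the negative of this generator.\<close>

lemma frag_of_zero_in_Null: "frag_of (m, 0) \<in> Null"
  using Null_uminus[OF Null_right_add[of m 0 0]] by (simp add: tate_carrier_0)

lemma normal_form_0: "normal_form (\<lambda>_. 0) (\<lambda>_. 0) \<in> Null"
  unfolding normal_form_def by (intro Null_sum Null_add frag_of_zero_in_Null)

lemma normal_form_add:
  assumes "tate_family g" "tate_family h" "tate_family g'" "tate_family h'"
  shows "normal_form (\<lambda>j. g j + g' j) (\<lambda>j. h j + h' j) - normal_form g h - normal_form g' h' \<in> Null"
proof -
  have "normal_form (\<lambda>j. g j + g' j) (\<lambda>j. h j + h' j) - normal_form g h - normal_form g' h' =
    (\<Sum>j\<in>UNIV. (frag_of (axis j (Polynomial.monom 1 0), g j + g' j) - frag_of (axis j (Polynomial.monom 1 0), g j)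
          - frag_of (axis j (Polynomial.monom 1 0), g' j))
      + (frag_of (axis j (Polynomial.monom 1 1), h j + h' j) - frag_of (axis j (Polynomial.monom 1 1), h j)
          - frag_of (axis j (Polynomial.monom 1 1), h' j)))"
    unfolding normal_form_def sum_subtractf[symmetric] by (intro sum.cong refl) simp
  also have "\<dots> \<in> Null"
    using assms Null_right_add unfolding tate_family_def
    by (intro Null_sum Null_add) (simp_all del: One_nat_def)
  finally show ?thesis .
qed

definition representable :: "(('a skew_poly ^ 'n) \<times> 'a fps \<Rightarrow>\<^sub>0 int) \<Rightarrow> bool" where
  "representable \<xi> \<longleftrightarrow> (\<exists>g h. tate_family g \<and> tate_family h \<and> \<xi> - normal_form g h \<in> Null)"

lemma representable_Null: "\<xi> \<in> Null \<Longrightarrow> representable \<xi>"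
  unfolding representable_def tate_family_def
  by (intro exI[of _ "\<lambda>_. 0"]) (simp add: tate_carrier_0 Null_diff normal_form_0)

lemma representable_add:
  assumes "representable \<xi>" "representable \<eta>"
  shows "representable (\<xi> + \<eta>)"
proof -
  obtain g h g' h' where t: "tate_family g" "tate_family h" "tate_family g'" "tate_family h'"
    and N: "\<xi> - normal_form g h \<in> Null" "\<eta> - normal_form g' h' \<in> Null"
    using assms unfolding representable_def by blast
  have "tate_family (\<lambda>j. g j + g' j)" "tate_family (\<lambda>j. h j + h' j)"
    using t unfolding tate_family_def by (blast intro: tate_carrier_add)+
  moreover have "(\<xi> + \<eta>) - normal_form (\<lambda>j. g j + g' j) (\<lambda>j. h j + h' j) \<in> Null"
    using Null_diff[OF Null_add[OF N] normal_form_add[OF t]] by (simp add: algebra_simps)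
  ultimately show ?thesis unfolding representable_def by blast
qed

text \<open>Additivity of normal forms, applied to a family and its negative, shows that the two
  normal forms cancel modulo \<open>Null\<close>.\<close>

lemma representable_uminus:
  assumes "representable \<xi>"
  shows "representable (- \<xi>)"
proof -
  obtain g h where t: "tate_family g" "tate_family h" and N: "\<xi> - normal_form g h \<in> Null"
    using assms unfolding representable_def by blast
  have t': "tate_family (\<lambda>j. - g j)" "tate_family (\<lambda>j. - h j)"
    using t unfolding tate_family_def by (blast intro: tate_carrier_uminus)+
  have "normal_form (\<lambda>_. 0) (\<lambda>_. 0) - normal_form g h - normal_form (\<lambda>j. - g j) (\<lambda>j. - h j) \<in> Null"
    using normal_form_add[OF t t'] by simp
  from Null_diff[OF Null_diff[OF this normal_form_0] N]
  have "- \<xi> - normal_form (\<lambda>j. - g j) (\<lambda>j. - h j) \<in> Null" by (simp add: add.commute)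
  with t' show ?thesis unfolding representable_def by blast
qed

lemma representable_cong: "representable \<eta> \<Longrightarrow> \<xi> - \<eta> \<in> Null \<Longrightarrow> representable \<xi>"
  using representable_add[of \<eta> "\<xi> - \<eta>"] representable_Null by simp

definition spanned :: "'a skew_poly ^ 'n \<Rightarrow> bool" where
  "spanned m \<longleftrightarrow> (\<forall>f\<in>tate_carrier ord. representable (frag_of (m, f)))"

text \<open>The polynomial moves across the tensor sign onto the series, which stays convergent.
  This is why \<open>spanned\<close> quantifies over all series.\<close>

lemma spanned_smult: "spanned m \<Longrightarrow> spanned (p \<odot>\<^bsub>motive \<theta> A\<^esub> m)"
  unfolding spanned_def
  using representable_cong[OF _ Null_smult] by (simp add: tate_carrier_poly_mult)

lemma spanned_add:
  assumes "spanned m" "spanned m'"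
  shows "spanned (m + m')"
  unfolding spanned_def
proof
  fix f assume f: "f \<in> tate_carrier ord"
  with assms have "representable (frag_of (m, f) + frag_of (m', f))"
    unfolding spanned_def by (blast intro: representable_add)
  moreover have "frag_of (m + m', f) - (frag_of (m, f) + frag_of (m', f)) \<in> Null"
    using Null_left_add[of m m' f] f by (simp add: diff_diff_eq)
  ultimately show "representable (frag_of (m + m', f))" by (rule representable_cong)
qed

lemma spanned_0: "spanned 0"
proof -
  have "frag_of (0, f) \<in> Null" if "f \<in> tate_carrier ord" for f
    using Null_uminus[OF Null_left_add[of 0 0 f]] that by simp
  then show ?thesis unfolding spanned_def by (blast intro: representable_Null)
qed

lemma spanned_sum: "(\<And>i. i \<in> I \<Longrightarrow> spanned (m i)) \<Longrightarrow> spanned (\<Sum>i\<in>I. m i)"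
  by (induction I rule: infinite_finite_induct) (auto intro: spanned_0 spanned_add)

lemma spanned_axis_scale:
  assumes "spanned (axis j (Polynomial.monom 1 n))"
  shows "spanned (axis j (Polynomial.monom a n))"
  using spanned_smult[OF assms, of "[:a:]"] skew_act_monom_axis[of a 0 j 1 n]
  by (simp add: motive_smult_const monom_0)

text \<open>All other summands of the normal form are tensors with the zero series.\<close>

lemma normal_form_single:
  "frag_of (axis j (Polynomial.monom 1 0), f) - normal_form (\<lambda>i. if i = j then f else 0) (\<lambda>_. 0) \<in> Null"
  "frag_of (axis j (Polynomial.monom 1 1), f) - normal_form (\<lambda>_. 0) (\<lambda>i. if i = j then f else 0) \<in> Null"
proof -
  let ?g = "\<lambda>i. if i = j then f else 0"
  let ?e = "\<lambda>n i. axis i (Polynomial.monom 1 n) :: 'a poly ^ 'n"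
  have "normal_form ?g (\<lambda>_. 0) - frag_of (?e 0 j, f) =
      (\<Sum>i\<in>UNIV - {j}. frag_of (?e 0 i, 0)) + (\<Sum>i\<in>UNIV. frag_of (?e 1 i, 0))"
    unfolding normal_form_def sum.distrib by (subst sum.remove[of UNIV j]) simp_all
  also have "\<dots> \<in> Null"
    by (intro Null_sum Null_add frag_of_zero_in_Null)
  finally show "frag_of (?e 0 j, f) - normal_form ?g (\<lambda>_. 0) \<in> Null"
    using Null_uminus by fastforce
  have "normal_form (\<lambda>_. 0) ?g - frag_of (?e 1 j, f) =
      (\<Sum>i\<in>UNIV. frag_of (?e 0 i, 0)) + (\<Sum>i\<in>UNIV - {j}. frag_of (?e 1 i, 0))"
    unfolding normal_form_def sum.distrib
    by (subst sum.remove[of UNIV j "\<lambda>i. frag_of (?e 1 i, ?g i)"]) simp_all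
  also have "\<dots> \<in> Null"
    by (intro Null_sum Null_add frag_of_zero_in_Null)
  finally show "frag_of (?e 1 j, f) - normal_form (\<lambda>_. 0) ?g \<in> Null"
    using Null_uminus by fastforce
qed

lemma spanned_basis: "spanned (axis j (Polynomial.monom 1 0))" "spanned (axis j (Polynomial.monom 1 1))"
proof -
  have "tate_family (\<lambda>_. 0)" "f \<in> tate_carrier ord \<Longrightarrow> tate_family (\<lambda>i. if i = j then f else 0)" for f
    by (simp_all add: tate_family_def tate_carrier_0)
  then show "spanned (axis j (Polynomial.monom 1 0))" "spanned (axis j (Polynomial.monom 1 1))"
    unfolding spanned_def representable_def using normal_form_single by blast+
qed

text \<open>T commutes with \<open>\<tau>\<close>, so this is the defining formula for T multiplied
  on the left by the n-th power of \<open>\<tau>\<close>, which raises every coefficient to the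
  power \<open>2 ^ n\<close>.\<close>

lemma motive_T_axis:
  "motive_T \<theta> A (axis j (Polynomial.monom 1 n)) =
     axis j (Polynomial.monom (\<theta> ^ 2 ^ n) n)
     + (\<Sum>l\<in>UNIV. axis l (Polynomial.monom ((A $ j $ l) ^ 2 ^ n) (Suc n)))
     + axis j (Polynomial.monom 1 (Suc (Suc n)))"
proof -
  have e: "motive_basis i = axis i (Polynomial.monom 1 0)" for i :: 'n
    by (simp add: motive_basis_def)
  have tau: "[:0, 1:] = Polynomial.monom (1::'a) 1" and const: "[:a:] = Polynomial.monom a 0" for a :: 'a
    by (simp_all add: monom_altdef)
  have T: "skew_act [:\<theta>:] (motive_basis i) + (\<Sum>l\<in>UNIV. skew_act [:A $ i $ l:] (motive_tau (motive_basis l)))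
         + motive_tau (motive_tau (motive_basis i))
      = axis i (Polynomial.monom \<theta> 0) + (\<Sum>l\<in>UNIV. axis l (Polynomial.monom (A $ i $ l) 1))
        + axis i (Polynomial.monom 1 2)" for i
    unfolding motive_tau_def e tau unfolding const
    by (simp only: skew_act_monom_axis) (simp add: numeral_2_eq_2)
  have "motive_T \<theta> A (axis j (Polynomial.monom 1 n)) =
      (\<Sum>i\<in>UNIV. if i = j then skew_act (Polynomial.monom 1 n) (axis j (Polynomial.monom \<theta> 0)
        + (\<Sum>l\<in>UNIV. axis l (Polynomial.monom (A $ j $ l) 1)) + axis j (Polynomial.monom 1 2)) else 0)"
    unfolding motive_T_def T by (intro sum.cong) (auto simp: axis_def skew_act_0_left)
  then show ?thesis
    by (simp add: skew_act_add_right[OF char2] skew_act_sum_right[OF char2] skew_act_monom_axis)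
qed

text \<open>By \<open>motive_T_axis\<close>, \<open>\<tau>\<^sup>n\<^sup>+\<^sup>2 e\<^sub>j\<close> is \<open>T \<tau>\<^sup>n e\<^sub>j\<close> up to lower powers of \<open>\<tau>\<close>, so the vectors
  \<open>e\<^sub>l\<close> and \<open>\<tau> e\<^sub>l\<close> suffice.\<close>

lemma spanned_axis: "spanned (axis j (Polynomial.monom 1 n))"
proof (induction n arbitrary: j rule: less_induct)
  case (less n)
  consider "n = 0" | "n = 1" | k where "n = Suc (Suc k)"
    by (metis One_nat_def not0_implies_Suc)
  then show ?case
  proof cases
    case (3 k)
    have cancel: "c = t + - a + - b" if "t = a + b + c" for a b c t :: "'a poly ^ 'n"
      using that by simp
    let ?a = "axis j (Polynomial.monom (\<theta> ^ 2 ^ k) k)"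
    let ?b = "\<lambda>l. axis l (Polynomial.monom (vec_nth (vec_nth A j) l ^ 2 ^ k) (Suc k))"
    have minus: "- axis l (Polynomial.monom a i) = axis l (Polynomial.monom (- a) i)" for l :: 'n and a :: 'a and i
      by (simp add: vec_eq_iff axis_def minus_monom)
    have "axis j (Polynomial.monom 1 n) = motive_T \<theta> A (axis j (Polynomial.monom 1 k)) + - ?a + (\<Sum>l\<in>UNIV. - ?b l)"
      unfolding 3 sum_negf by (rule cancel[OF motive_T_axis])
    also have "\<dots> = motive_T \<theta> A (axis j (Polynomial.monom 1 k))
       + axis j (Polynomial.monom (- (\<theta> ^ 2 ^ k)) k)
       + (\<Sum>l\<in>UNIV. axis l (Polynomial.monom (- (vec_nth (vec_nth A j) l ^ 2 ^ k)) (Suc k)))"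
      by (simp only: minus)
    also have "spanned \<dots>"
    proof (intro spanned_add spanned_sum)
      show "spanned (motive_T \<theta> A (axis j (Polynomial.monom 1 k)))"
        unfolding motive_smult_T[symmetric] by (rule spanned_smult) (rule less.IH, simp add: 3)
    qed (rule spanned_axis_scale, rule less.IH, simp add: 3)+
    finally show ?thesis .
  qed (use spanned_basis in simp_all)
qed

lemma spanned: "spanned m"
proof -
  have "m = (\<Sum>j\<in>UNIV. \<Sum>k\<le>Polynomial.degree (m $ j). axis j (Polynomial.monom (Polynomial.coeff (m $ j) k) k))"
  proof -
    have "(\<Sum>k\<le>Polynomial.degree (m $ j). axis j (Polynomial.monom (Polynomial.coeff (m $ j) k) k)) = axis j (m $ j)" for j
      by (simp add: vec_eq_iff axis_def poly_as_sum_of_monoms)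
    then show ?thesis unfolding sum_axis by (simp only: sum_axis vec_lambda_eta)
  qed
  also have "spanned \<dots>"
    by (intro spanned_sum) (rule spanned_axis_scale, rule spanned_axis)
  finally show "spanned m" .
qed

lemma representable:
  assumes "\<xi> \<in> carrier F"
  shows "representable \<xi>"
proof -
  have "Poly_Mapping.keys \<xi> \<subseteq> UNIV \<times> tate_carrier ord"
    using assms by simp
  then show ?thesis
  proof (induction \<xi> rule: free_Abelian_group_induct[consumes 1, case_names zero diff frag_of])
    case zero
    show ?case by (rule representable_Null) (rule Null_0)
  next
    case (diff \<xi> \<eta>)
    then show ?case using representable_add[OF _ representable_uminus, of \<xi> \<eta>] by simp
  next
    case (frag_of a)
    then show ?case using spanned unfolding spanned_def by auto
  qed
qed

text \<open>Modulo \<open>Null\<close> every formal sum is a normal form, and \<open>\<Phi>\<close>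
  determines its coefficients; so \<open>\<Phi>\<close> is injective on the tensor product.\<close>

lemma Null_iff:
  assumes "\<xi> \<in> carrier F"
  shows "\<xi> \<in> Null \<longleftrightarrow> \<Phi> \<xi> = 0"
proof
  assume 0: "\<Phi> \<xi> = 0"
  obtain g h where N: "\<xi> - normal_form g h \<in> Null"
    using representable[OF assms] unfolding representable_def by blast
  then have "\<Phi> (normal_form g h) = 0"
    using \<Phi>_Null[OF N] 0 by (simp add: \<Phi>_diff)
  then have "g = (\<lambda>_. 0)" "h = (\<lambda>_. 0)"
    by (auto simp: \<Phi>_normal_form zero_prod_def vec_eq_iff)
  with N have "\<xi> - normal_form (\<lambda>_. 0) (\<lambda>_. 0) \<in> Null" by simp
  from Null_add[OF this normal_form_0] show "\<xi> \<in> Null" by simp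
qed (rule \<Phi>_Null)

lemma frag_extend_in_F:
  assumes "\<xi> \<in> carrier F" "\<And>f. f \<in> tate_carrier ord \<Longrightarrow> \<psi> f \<in> tate_carrier ord"
  shows "frag_extend (\<lambda>(x, y). frag_of (\<phi> x, \<psi> y)) \<xi> \<in> carrier F"
proof -
  have "Poly_Mapping.keys \<xi> \<subseteq> UNIV \<times> tate_carrier ord"
    using assms(1) by simp
  then show ?thesis
  proof (induction \<xi> rule: free_Abelian_group_induct[consumes 1, case_names zero diff frag_of])
    case (diff \<xi> \<eta>)
    then show ?case unfolding frag_extend_diff by (intro diff_in_F)
  qed (use assms(2) in auto)
qed

text \<open>Through \<open>Null_iff\<close> this reduces to \<open>tau_coord\<close> sending 0 to
  0.\<close>

lemma tau_Null: "motive_tate_tau ord \<theta> A Null = Null"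
  unfolding motive_tate_tau_def
proof (rule tensor_map_Null)
  fix \<xi> assume \<xi>: "\<xi> \<in> Null"
  then show "frag_extend (\<lambda>(x, y). frag_of (motive_tau x, tate_tau y)) \<xi> \<in> Null"
    using \<Phi>_Null[OF \<xi>] Null_in_F[OF \<xi>]
    by (subst Null_iff) (auto intro!: frag_extend_in_F tate_tau_in_carrier simp: \<Phi>_tau tau_coord_0
        simp del: tensor_free_simps(3))
qed

lemma smult_Null: "p \<odot>\<^bsub>motive_tate ord \<theta> A\<^esub> Null = Null"
proof -
  have "tensor_map ring_of_type_algebra (motive \<theta> A) (tate ord) (\<lambda>x. p \<odot>\<^bsub>motive \<theta> A\<^esub> x) (\<lambda>y. y) Null = Null"
  proof (rule tensor_map_Null)
    fix \<xi> assume \<xi>: "\<xi> \<in> Null"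
    then show "frag_extend (\<lambda>(x, y). frag_of (p \<odot>\<^bsub>motive \<theta> A\<^esub> x, y)) \<xi> \<in> Null"
      using \<Phi>_Null[OF \<xi>] Null_in_F[OF \<xi>] frag_extend_in_F[OF Null_in_F[OF \<xi>], of "\<lambda>y. y"]
      by (subst Null_iff) (auto simp: \<Phi>_smult simp del: tensor_free_simps(3))
  qed
  then show ?thesis by (simp add: motive_tate_def tensor_product_def)
qed

section \<open>From invariant tensors to the recurrence\<close>

lemma invariant_trivial:
  assumes trivial: "\<And>y :: nat \<Rightarrow> 'a ^ 'n. (\<And>i. (\<lambda>n. ord (y n $ i)) \<longlonglongrightarrow> \<infinity>) \<Longrightarrow>
      (\<And>n i. \<theta>^2 * (y n $ i)^4 + (\<Sum>j\<in>UNIV. A $ j $ i * (y n $ j)^2) + y n $ i =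
        (if n = 0 then 0 else (y (n - 1) $ i)^4)) \<Longrightarrow> \<forall>n. y n = 0"
    and u: "u \<in> carrier (motive_tate ord \<theta> A)" and tau: "motive_tate_tau ord \<theta> A u = u"
  shows "u = Null"
proof -
  obtain \<xi> where \<xi>: "\<xi> \<in> carrier F" and u_eq: "u = Null #>\<^bsub>F\<^esub> \<xi>"
    using u unfolding motive_tate_def carrier_tensor_product by blast
  obtain g h where t: "tate_family h" and N: "\<xi> - normal_form g h \<in> Null"
    using representable[OF \<xi>] unfolding representable_def by blast
  let ?\<rho> = "normal_form g h"
  have "?\<rho> \<in> u" using Null_uminus[OF N] by (simp add: u_eq mem_coset_iff)
  with tau have "frag_extend (\<lambda>(x, y). frag_of (motive_tau x, tate_tau y)) ?\<rho> \<in> u"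
    unfolding motive_tate_tau_def by (rule tensor_map_fixed)
  then have "frag_extend (\<lambda>(x, y). frag_of (motive_tau x, tate_tau y)) ?\<rho> - \<xi> \<in> Null"
    by (simp add: u_eq mem_coset_iff)
  from \<Phi>_Null[OF this] \<Phi>_Null[OF N] have "tau_coord \<theta> A (\<Phi> ?\<rho>) = \<Phi> ?\<rho>"
    by (simp add: \<Phi>_diff \<Phi>_tau)
  \<comment> \<open>The coordinates are fixed by \<open>tau_coord\<close>: the first component
    expresses \<open>g\<close> through \<open>h\<close>, and substituting it into the second leaves
    an equation in \<open>h\<close> alone.\<close>
  then have g: "g i = (fps_X - fps_const \<theta>) * tate_tau (h i)"
    and h: "h i = tate_tau (g i) - (\<Sum>j\<in>UNIV. fps_const (A $ j $ i) * tate_tau (h j))" for i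
    by (simp_all add: \<Phi>_normal_form tau_coord_def vec_eq_iff)
  define y where "y n = (\<chi> i. fps_nth (h i) n)" for n
  have "\<forall>n. y n = 0"
  proof (rule trivial)
    show "(\<lambda>n. ord (y n $ i)) \<longlonglongrightarrow> \<infinity>" for i
      using t by (simp add: y_def tate_family_def tate_carrier_def)
    fix n i
    have "fps_X - fps_const \<theta> = fps_X + fps_const \<theta>"
      by (simp only: diff_conv_add_uminus fps_const_neg char2_uminus[OF char2])
    then have "tate_tau (fps_X - fps_const \<theta>) = fps_X + fps_const (\<theta>^2)"
      by (simp only: tate_tau_add[OF char2] tate_tau_X tate_tau_const)
    then have "tate_tau (g i) = (fps_X + fps_const (\<theta>^2)) * tate_tau (tate_tau (h i))"
      unfolding g tate_tau_mult[OF char2] by simp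
    \<comment> \<open>Multiplication by T shifts the index, which brings in the previous
      coefficient, or 0 when \<open>n = 0\<close>.\<close>
    then have "fps_nth (tate_tau (g i)) n =
        (if n = 0 then 0 else (y (n - 1) $ i)^4) + \<theta>^2 * (y n $ i)^4"
      by (simp add: distrib_right y_def flip: power_mult)
    then have e: "y n $ i = (if n = 0 then 0 else (y (n - 1) $ i)^4) + \<theta>^2 * (y n $ i)^4
        + (\<Sum>j\<in>UNIV. A $ j $ i * (y n $ j)^2)"
      using arg_cong[OF h, of "\<lambda>f. fps_nth f n" i]
      by (simp add: y_def fps_sum_nth char2_uminus[OF char2] diff_conv_add_uminus del: add_uminus_conv_diff)
    \<comment> \<open>In characteristic two, terms change sides without a sign.\<close>
    have cancel: "a + s + b = c" if "b = c + a + s" for a b c s :: 'a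
    proof -
      have "a + s + b = c + (a + a) + (s + s)"
        unfolding that by (simp only: ac_simps)
      then show ?thesis by (simp only: char2_add_self[OF char2] add_0_right)
    qed
    show "\<theta>^2 * (y n $ i)^4 + (\<Sum>j\<in>UNIV. A $ j $ i * (y n $ j)^2) + y n $ i
      = (if n = 0 then 0 else (y (n - 1) $ i)^4)"
      by (rule cancel[OF e])
  qed
  then have "h i = 0" for i
    by (simp add: y_def vec_eq_iff fps_eq_iff)
  with g have "g = (\<lambda>_. 0)" "h = (\<lambda>_. 0)" by auto
  with N have "\<xi> - normal_form (\<lambda>_. 0) (\<lambda>_. 0) \<in> Null" by simp
  from Null_add[OF this normal_form_0] have "\<xi> \<in> Null" by simp
  then show ?thesis by (simp add: u_eq coset_Null)
qed

lemma h1_eq_0: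
  assumes "\<And>y :: nat \<Rightarrow> 'a ^ 'n. (\<And>i. (\<lambda>n. ord (y n $ i)) \<longlonglongrightarrow> \<infinity>) \<Longrightarrow>
      (\<And>n i. \<theta>^2 * (y n $ i)^4 + (\<Sum>j\<in>UNIV. A $ j $ i * (y n $ j)^2) + y n $ i =
        (if n = 0 then 0 else (y (n - 1) $ i)^4)) \<Longrightarrow> \<forall>n. y n = 0"
  shows "h1 ord \<theta> A = 0"
  unfolding h1_def
proof (rule module_rank_trivial[where r = 0 and s = 1])
  have zero: "\<zero>\<^bsub>H1 ord \<theta> A\<^esub> = Null"
    by (simp add: H1_def motive_tate_def zero_tensor_product)
  have Null: "Null \<in> carrier (motive_tate ord \<theta> A)"
    unfolding motive_tate_def carrier_tensor_product
    by (rule CollectI, rule exI[of _ 0], rule conjI[OF coset_Null[OF Null_0, symmetric] Null_in_F[OF Null_0]])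
  show "carrier (H1 ord \<theta> A) = {\<zero>\<^bsub>H1 ord \<theta> A\<^esub>}"
    unfolding zero
  proof (intro equalityI subsetI)
    fix u assume "u \<in> carrier (H1 ord \<theta> A)"
    then have "u \<in> carrier (motive_tate ord \<theta> A)" "motive_tate_tau ord \<theta> A u = u"
      by (simp_all add: H1_def)
    then show "u \<in> {Null}" using invariant_trivial[OF assms] by blast
  qed (simp add: H1_def Null tau_Null)
  show "\<zero>\<^bsub>H1 ord \<theta> A\<^esub> \<oplus>\<^bsub>H1 ord \<theta> A\<^esub> \<zero>\<^bsub>H1 ord \<theta> A\<^esub> = \<zero>\<^bsub>H1 ord \<theta> A\<^esub>"
    unfolding zero by (simp add: H1_def motive_tate_def add_zero_tensor_product)
  show "0 \<odot>\<^bsub>H1 ord \<theta> A\<^esub> \<zero>\<^bsub>H1 ord \<theta> A\<^esub> = \<zero>\<^bsub>H1 ord \<theta> A\<^esub>"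
    "1 \<odot>\<^bsub>H1 ord \<theta> A\<^esub> \<zero>\<^bsub>H1 ord \<theta> A\<^esub> = \<zero>\<^bsub>H1 ord \<theta> A\<^esub>"
    unfolding zero using smult_Null by (simp_all add: H1_def)
qed (auto simp: F2T_def coeff_pCons one_pCons split: nat.split)

end

subsection \<open>The recurrence\<close>

text \<open>\<open>c4\<close> is the coefficient of \<open>x^4\<close> once \<open>z\<close> is
  eliminated; its valuation is the number t of the theorem.\<close>

locale motive_valuation = valued_field ord for ord :: "'a::field \<Rightarrow> ereal" +
  fixes \<theta> a11 a12 a21 :: 'a and v :: real and c4 :: 'a
  assumes char2: "CHAR('a) = 2"
    and ord_\<theta>: "ord \<theta> = ereal (-1)"
    and ord_a11: "ord a11 = ereal (-1)"
    and ord_a21: "ord a21 = ereal v"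
    and c4_def: "c4 = \<theta>^2 / a21 + \<theta>^4 / a21^4 - a12^2"
    and v_ge: "v \<ge> 2"
    and ord_c4: "ord c4 \<ge> ereal (- (16 / 7) * v - 24 / 7)"
begin

lemma a21_nonzero: "a21 \<noteq> 0"
  using ord_a21 by auto

lemma fourth_power_add: "(x + y) ^ 4 = x ^ 4 + (y::'a) ^ 4"
  using char2_power_add[OF char2, of x y 2] by simp

text \<open>In characteristic two \<open>a12^2\<close> is
  \<open>\<theta>^4 / a21^4 + \<theta>^2 / a21 + c4\<close>. The first term has valuation -4 - 4v,
  strictly below the other two.\<close>

lemma ord_a12: "ord a12 = ereal (- 2 - 2 * v)"
proof -
  have 1: "ord (\<theta>^4 / a21^4) = ereal (- 4 - 4 * v)"
    using ord_real(3)[OF ord_real(2)[OF ord_\<theta>, of 4] ord_real(2)[OF ord_a21, of 4]] by simp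
  have 2: "ord (\<theta>^2 / a21) = ereal (- 2 - v)"
    using ord_real(3)[OF ord_real(2)[OF ord_\<theta>, of 2] ord_a21] by simp
  have "ord (\<theta>^4 / a21^4) < ord c4"
    by (rule less_le_trans[OF _ ord_c4]) (use v_ge in \<open>simp add: 1 \<close>)
  moreover have "ord (\<theta>^4 / a21^4) < ord (\<theta>^2 / a21)"
    using v_ge by (simp add: 1 2)
  ultimately have "ord (\<theta>^4 / a21^4 + (\<theta>^2 / a21 + c4)) = ereal (- 4 - 4 * v)"
    using 1 by (metis ord_add_dominant ord_add_less)
  moreover have "\<theta>^4 / a21^4 + (\<theta>^2 / a21 + c4) = a12 ^ 2"
  proof -
    have "\<theta>^4 / a21^4 + (\<theta>^2 / a21 + c4) =
        (\<theta>^4 / a21^4 + \<theta>^4 / a21^4) + (\<theta>^2 / a21 + \<theta>^2 / a21) - a12 ^ 2"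
      unfolding c4_def by (simp only: ac_simps add_diff_eq)
    then show ?thesis by (simp only: char2_add_self[OF char2]) (simp add: char2_uminus[OF char2])
  qed
  ultimately show ?thesis using ord_power_cancel[of a12 2 "- 4 - 4 * v"] by (simp add: field_simps)
qed

text \<open>Eliminating \<open>z\<close> from the recurrence leaves \<open>elim_poly x = elim_rhs xp zp\<close>; the bound on \<open>t\<close> says
  that the coefficient of \<open>x\<^sup>4\<close> lies on or above the Newton polygon of the other terms.\<close>

abbreviation elim_poly :: "'a \<Rightarrow> 'a" where
  "elim_poly x \<equiv> \<theta>^12 / a21^4 * x^16 + \<theta>^4 * a11^4 / a21^4 * x^8 + c4 * x^4 + a11 / a21 * x^2 + x / a21"

definition elim_rhs :: "'a \<Rightarrow> 'a \<Rightarrow> 'a" where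
  "elim_rhs x z = z^8 + x^4 / a21 + \<theta>^4 / a21^4 * x^16"

text \<open>\<open>(xp, zp)\<close> is the preceding pair. The matrix acts transposed:
  \<open>a21\<close> goes with \<open>z^2\<close> in the first equation and \<open>a12\<close> with
  \<open>x^2\<close> in the second.\<close>

definition recurrence :: "'a \<Rightarrow> 'a \<Rightarrow> 'a \<Rightarrow> 'a \<Rightarrow> bool" where
  "recurrence xp zp x z \<longleftrightarrow>
     \<theta>^2 * x^4 + a11 * x^2 + a21 * z^2 + x = xp^4 \<and>
     \<theta>^2 * z^4 + a12 * x^2 + z = zp^4"

text \<open>The first equation determines \<open>z^2\<close>. The square of the second involves
  \<open>z\<close> only through \<open>z^8\<close> and \<open>z^2\<close>, so \<open>z\<close> can
  be substituted away.\<close>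

lemma elim_poly_eq:
  assumes "recurrence xp zp x z"
  shows "elim_poly x = elim_rhs xp zp"
proof -
  define u where "u = \<theta>^2 * x^4 + a11 * x^2 + x + xp^4"
  have u: "a21 * z^2 = u"
  proof -
    have "u + a21 * z^2 = (\<theta>^2 * x^4 + a11 * x^2 + a21 * z^2 + x) + xp^4"
      unfolding u_def by (simp only: ac_simps)
    also have "\<dots> = 0"
      using assms unfolding recurrence_def by (simp only: char2_add_self[OF char2])
    finally have "a21 * z^2 + u = 0" by (simp only: add.commute)
    then show ?thesis by (simp add: eq_neg_iff_add_eq_0[symmetric] char2_uminus[OF char2])
  qed
  then have z2: "z^2 = u / a21" using a21_nonzero by (simp add: field_simps)
  have "z^8 = (z^2)^4" by (simp flip: power_mult)
  then have z8: "z^8 = u^4 / a21^4" by (simp add: z2 power_divide)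
  have u4: "u^4 = \<theta>^8 * x^16 + a11^4 * x^8 + x^4 + xp^16"
    unfolding u_def by (simp add: fourth_power_add power_mult_distrib flip: power_mult)
  have "zp^8 = (\<theta>^2 * z^4 + a12 * x^2 + z)^2"
    using assms unfolding recurrence_def by (simp flip: power_mult)
  also have "\<dots> = \<theta>^4 * z^8 + a12^2 * x^4 + z^2"
    by (simp add: char2_square_add[OF char2] power_mult_distrib flip: power_mult)
  finally have e: "zp^8 = \<theta>^4 * z^8 + a12^2 * x^4 + z^2" .
  have "elim_rhs xp zp = \<theta>^4 * (u^4 / a21^4) + a12^2 * x^4 + u / a21 + xp^4 / a21 + \<theta>^4 / a21^4 * xp^16"
    unfolding elim_rhs_def e z8 z2 ..
  \<comment> \<open>The contributions of \<open>xp\<close> hidden in \<open>u\<close> meet the terms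
    of \<open>elim_rhs\<close> in equal pairs, which cancel.\<close>
  also have "\<dots> = \<theta>^12 / a21^4 * x^16 + \<theta>^4 * a11^4 / a21^4 * x^8
      + (\<theta>^2 / a21 + \<theta>^4 / a21^4 + a12^2) * x^4 + a11 / a21 * x^2 + x / a21
      + (xp^4 / a21 + xp^4 / a21) + (\<theta>^4 / a21^4 * xp^16 + \<theta>^4 / a21^4 * xp^16)"
  proof -
    have "\<theta>^12 = \<theta>^4 * \<theta>^8" by (simp flip: power_add)
    then show ?thesis unfolding u4 unfolding u_def divide_inverse by (simp only: algebra_simps)
  qed
  finally show ?thesis
    unfolding c4_def by (simp add: char2_add_self[OF char2] diff_conv_add_uminus char2_uminus[OF char2] del: add_uminus_conv_diff)
qed

section \<open>The Newton polygon of the eliminated equation\<close>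

context
  fixes x :: 'a and \<xi> :: real
  assumes ord_x: "ord x = ereal \<xi>"
begin

text \<open>As functions of \<open>\<xi>\<close>, the lines of degree 16 and 8 cross at 1/2, and
  those of degree 8 and 1 at (8 + 3v)/7. The lower bound for the term of degree 4 passes exactly
  through the second crossing.\<close>

lemma ord_terms:
  "ord (\<theta>^12 / a21^4 * x^16) = ereal (16 * \<xi> - 12 - 4 * v)"
  "ord (\<theta>^4 * a11^4 / a21^4 * x^8) = ereal (8 * \<xi> - 8 - 4 * v)"
  "ord (a11 / a21 * x^2) = ereal (2 * \<xi> - 1 - v)"
  "ord (x / a21) = ereal (\<xi> - v)"
  "ord (c4 * x^4) \<ge> ereal (4 * \<xi> - 16 / 7 * v - 24 / 7)"
proof -
  note o = ord_real(2)[OF ord_x] ord_real(2)[OF ord_\<theta>] ord_real(2)[OF ord_a21] ord_real(2)[OF ord_a11]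
  show "ord (\<theta>^12 / a21^4 * x^16) = ereal (16 * \<xi> - 12 - 4 * v)"
    by (subst ord_real(1)[OF ord_real(3)[OF o(2,3)] o(1)]) simp
  show "ord (\<theta>^4 * a11^4 / a21^4 * x^8) = ereal (8 * \<xi> - 8 - 4 * v)"
    by (subst ord_real(1)[OF ord_real(3)[OF ord_real(1)[OF o(2,4)] o(3)] o(1)]) simp
  show "ord (a11 / a21 * x^2) = ereal (2 * \<xi> - 1 - v)"
    by (subst ord_real(1)[OF ord_real(3)[OF ord_a11 ord_a21] o(1)]) simp
  show "ord (x / a21) = ereal (\<xi> - v)"
    by (rule ord_real(3)[OF ord_x ord_a21])
  have "ereal (- (16 / 7) * v - 24 / 7) + ereal (4 * \<xi>) \<le> ord c4 + ereal (4 * \<xi>)"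
    using ord_c4 by (rule add_right_mono)
  then show "ord (c4 * x^4) \<ge> ereal (4 * \<xi> - 16 / 7 * v - 24 / 7)"
    unfolding ord_mult o by (simp add: algebra_simps)
qed

lemma ord_c4_greater: "r < 4 * \<xi> - 16 / 7 * v - 24 / 7 \<Longrightarrow> ereal r < ord (c4 * x^4)"
  by (rule less_le_trans[OF _ ord_terms(5)]) simp

lemma ord_elim_poly_below:
  assumes "\<xi> < 1 / 2"
  shows "ord (elim_poly x) = ereal (16 * \<xi> - 12 - 4 * v)"
  by (rule ord_dominant5; (rule ord_c4_greater)?; (unfold ord_terms)?)
    (use assms v_ge in \<open>simp; fail\<close> | use assms v_ge in \<open>simp, linarith\<close>)+

lemma ord_elim_poly_middle:
  assumes "1 / 2 < \<xi>" "7 * \<xi> < 8 + 3 * v"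
  shows "ord (elim_poly x) = ereal (8 * \<xi> - 8 - 4 * v)"
proof -
  \<comment> \<open>The dominant term is moved to the front, as \<open>ord_dominant5\<close>
    expects.\<close>
  have "ord (\<theta>^4 * a11^4 / a21^4 * x^8 + \<theta>^12 / a21^4 * x^16 + c4 * x^4 + a11 / a21 * x^2 + x / a21)
      = ereal (8 * \<xi> - 8 - 4 * v)"
    by (rule ord_dominant5; (rule ord_c4_greater)?; (unfold ord_terms)?)
      (use assms v_ge in \<open>simp; fail\<close> | use assms v_ge in \<open>simp, linarith\<close>)+
  then show ?thesis by (simp add: ac_simps)
qed

lemma ord_elim_poly_above:
  assumes "7 * \<xi> > 8 + 3 * v"
  shows "ord (elim_poly x) = ereal (\<xi> - v)"
proof -
  have "ord (x / a21 + \<theta>^12 / a21^4 * x^16 + \<theta>^4 * a11^4 / a21^4 * x^8 + c4 * x^4 + a11 / a21 * x^2)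
      = ereal (\<xi> - v)"
    by (rule ord_dominant5; (rule ord_c4_greater)?; (unfold ord_terms)?)
      (use assms v_ge in \<open>simp; fail\<close> | use assms v_ge in \<open>simp, linarith\<close>)+
  then show ?thesis by (simp add: ac_simps)
qed

text \<open>Here the terms of degree 8 and 1 tie, possibly with that of degree 4, so cancellation
  may raise the valuation.\<close>

lemma ord_elim_poly_corner:
  assumes "7 * \<xi> = 8 + 3 * v"
  shows "ord (elim_poly x) \<ge> ereal (\<xi> - v)"
proof -
  have "ereal (\<xi> - v) \<le> ord (c4 * x^4)"
    by (rule order_trans[OF _ ord_terms(5)]) (use assms in \<open>simp add: field_simps\<close>)
  moreover have "\<xi> - v \<le> 16 * \<xi> - 12 - 4 * v" "\<xi> - v \<le> 8 * \<xi> - 8 - 4 * v"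
    "\<xi> - v \<le> 2 * \<xi> - 1 - v"
    using assms v_ge by (simp_all add: field_simps)
  ultimately show ?thesis
    by (intro ord_add_le) (unfold ord_terms, simp_all only: ereal_less_eq order_refl)
qed

end

text \<open>The valuations of \<open>\<theta>^2 * z^4\<close> and \<open>z\<close> agree exactly
  when \<open>ord z\<close> is 2/3, and both are then 2/3. A sum of valuation below 2/3 forces the
  quartic term to dominate.\<close>

lemma ord_z:
  assumes eq: "\<theta>^2 * z^4 + z = c" and c: "ord c = ereal \<gamma>" and "\<gamma> < 2 / 3"
  shows "ord z = ereal ((\<gamma> + 2) / 4)"
proof -
  have "c \<noteq> 0" using c by auto
  then have "z \<noteq> 0" using eq by auto
  then obtain \<zeta> where z: "ord z = ereal \<zeta>" by (rule ord_finite)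
  have t: "ord (\<theta>^2 * z^4) = ereal (4 * \<zeta> - 2)"
    by (subst ord_real(1)[OF ord_real(2)[OF ord_\<theta>] ord_real(2)[OF z]]) simp
  show ?thesis
  proof (cases "\<zeta> < 2 / 3")
    case True
    then have "ord (\<theta>^2 * z^4) < ord z" using t z by simp
    with ord_add_dominant eq c t have "ereal \<gamma> = ereal (4 * \<zeta> - 2)" by metis
    with z show ?thesis by simp
  next
    case False
    then have "ereal (2 / 3) \<le> ord (\<theta>^2 * z^4)" "ereal (2 / 3) \<le> ord z"
      unfolding t z by simp_all
    then have "ereal (2 / 3) \<le> ord c"
      unfolding eq[symmetric] by (rule ord_add_le)
    with c assms(3) show ?thesis by simp
  qed
qed

text \<open>The assumption on \<open>zp\<close> makes \<open>a12 * x^2\<close> dominate the second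
  equation, so \<open>ord_z\<close> applies with the valuation of that term.\<close>

lemma ord_z_step:
  assumes rec: "recurrence xp zp x z" and x: "ord x = ereal \<xi>" and zp: "ord (zp^4) > ereal (2 * \<xi> - 2 - 2 * v)"
    and small: "2 * \<xi> - 2 - 2 * v < 2 / 3"
  shows "ord z = ereal ((\<xi> - v) / 2)"
proof -
  have ax: "ord (a12 * x^2) = ereal (2 * \<xi> - 2 - 2 * v)"
    by (subst ord_real(1)[OF ord_a12 ord_real(2)[OF x]]) simp
  have o: "ord (a12 * x^2 + zp^4) = ereal (2 * \<xi> - 2 - 2 * v)"
    using ord_add_dominant zp unfolding ax[symmetric] by blast
  have "\<theta>^2 * z^4 + z = a12 * x^2 + zp^4"
  proof -
    have "a12 * x^2 + zp^4 = a12 * x^2 + (\<theta>^2 * z^4 + a12 * x^2 + z)"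
      using rec by (simp add: recurrence_def)
    also have "\<dots> = (a12 * x^2 + a12 * x^2) + (\<theta>^2 * z^4 + z)"
      by (simp only: ac_simps)
    finally show ?thesis by (simp add: char2_add_self[OF char2])
  qed
  from ord_z[OF this o small] show ?thesis by (simp add: field_simps)
qed

text \<open>Nonzero solutions of the homogeneous equation have \<open>ord x\<close> equal to \<open>1/2\<close> or \<open>(8 + 3v)/7\<close>. Starting
  there, a step gives either \<open>ord x = 1/2\<close> or \<open>ord x = ord zp + 1 + v/2\<close>, and in both cases
  \<open>ord z = (ord x - v)/2\<close>; this region is stable under these steps.\<close>

definition trapped :: "'a \<Rightarrow> 'a \<Rightarrow> bool" where
  "trapped x z \<longleftrightarrow> (\<exists>\<xi> \<zeta>. ord x = ereal \<xi> \<and> ord z = ereal \<zeta> \<and>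
     1 - 2 * v \<le> 4 * \<zeta> \<and> 7 * \<zeta> \<le> 4 - 2 * v \<and> 4 * \<xi> > 2 * \<zeta> + 1 + v)"

text \<open>With this value of \<open>ord z\<close>, the first two inequalities of
  \<open>trapped\<close> become the two bounds on \<open>\<xi>\<close>, and the third becomes
  \<open>\<xi> > 1 / 3\<close>.\<close>

lemma trappedI:
  assumes "ord x = ereal \<xi>" "ord z = ereal ((\<xi> - v) / 2)" "1 / 2 \<le> \<xi>" "7 * \<xi> \<le> 8 + 3 * v"
  shows "trapped x z"
proof -
  have "1 - 2 * v \<le> 4 * ((\<xi> - v) / 2)" "7 * ((\<xi> - v) / 2) \<le> 4 - 2 * v"
    "4 * \<xi> > 2 * ((\<xi> - v) / 2) + 1 + v"
    using assms(3,4) by (simp_all add: field_simps)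
  then show ?thesis
    using assms(1,2) unfolding trapped_def by blast
qed

lemma trapped_start:
  assumes rec: "recurrence 0 0 x z" and nz: "x \<noteq> 0 \<or> z \<noteq> 0"
  shows "trapped x z"
proof -
  \<comment> \<open>If \<open>x\<close> were 0, the first equation would reduce to
    \<open>a21 * z^2 = 0\<close>.\<close>
  have "x \<noteq> 0"
    using rec nz a21_nonzero by (auto simp: recurrence_def)
  then obtain \<xi> where x: "ord x = ereal \<xi>" by (rule ord_finite)
  have P: "ord (elim_poly x) = \<infinity>"
    unfolding elim_poly_eq[OF rec] elim_rhs_def by simp
  \<comment> \<open>Off the two breaks the polynomial would have finite valuation, but here it
    vanishes.\<close>
  have "\<not> \<xi> < 1 / 2" "\<not> (1 / 2 < \<xi> \<and> 7 * \<xi> < 8 + 3 * v)" "\<not> 7 * \<xi> > 8 + 3 * v"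
    using ord_elim_poly_below[OF x] ord_elim_poly_middle[OF x] ord_elim_poly_above[OF x] P by auto
  then consider "\<xi> = 1 / 2" | "7 * \<xi> = 8 + 3 * v" by fastforce
  then have \<xi>: "(\<xi> = 1 / 2 \<or> 7 * \<xi> = 8 + 3 * v) \<and> 2 * \<xi> - 2 - 2 * v < 2 / 3"
    using v_ge by cases auto
  then have "ord z = ereal ((\<xi> - v) / 2)"
    by (intro ord_z_step[OF rec x]) auto
  with x show ?thesis
    by (rule trappedI) (use \<xi> v_ge in auto)
qed

lemma trapped_step:
  assumes rec: "recurrence xp zp x z" and "trapped xp zp"
  shows "trapped x z"
proof -
  obtain \<xi>p \<zeta> where xp: "ord xp = ereal \<xi>p" and zp: "ord zp = ereal \<zeta>"
    and \<zeta>: "1 - 2 * v \<le> 4 * \<zeta>" "7 * \<zeta> \<le> 4 - 2 * v" and \<xi>p: "4 * \<xi>p > 2 * \<zeta> + 1 + v"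
    using assms(2) unfolding trapped_def by blast
  have \<zeta>0: "\<zeta> \<le> 0" using \<zeta> v_ge by linarith
  have o: "ord (zp^8) = ereal (8 * \<zeta>)" "ord (zp^4) = ereal (4 * \<zeta>)"
    "ord (xp^4 / a21) = ereal (4 * \<xi>p - v)"
    "ord (\<theta>^4 / a21^4 * xp^16) = ereal (16 * \<xi>p - 4 - 4 * v)"
    using ord_real(2)[OF zp] ord_real(3)[OF ord_real(2)[OF xp, of 4] ord_a21]
      ord_real(1)[OF ord_real(3)[OF ord_real(2)[OF ord_\<theta>, of 4] ord_real(2)[OF ord_a21, of 4]] ord_real(2)[OF xp, of 16]]
    by simp_all
  \<comment> \<open>The third inequality of \<open>trapped\<close> is, multiplied by 4, the second
    claim; with \<open>\<zeta> \<le> 0\<close> it also gives the first.\<close>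
  have "ord (zp^8) < ord (xp^4 / a21)" "ord (zp^8) < ord (\<theta>^4 / a21^4 * xp^16)"
    unfolding o unfolding less_ereal.simps using \<xi>p \<zeta>0 by linarith+
  then have R: "ord (elim_rhs xp zp) = ereal (8 * \<zeta>)"
    unfolding elim_rhs_def by (metis ord_add_dominant o(1))
  then have "elim_rhs xp zp \<noteq> 0" by auto
  then have "x \<noteq> 0" using elim_poly_eq[OF rec] by auto
  then obtain \<xi> where x: "ord x = ereal \<xi>" by (rule ord_finite)
  note P = R[folded elim_poly_eq[OF rec]]
  have "\<xi> = 1 / 2 \<or> \<xi> = \<zeta> + 1 + v / 2"
  proof -
    consider "\<xi> < 1 / 2" | "\<xi> = 1 / 2" | "1 / 2 < \<xi>" "7 * \<xi> < 8 + 3 * v"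
      | "7 * \<xi> = 8 + 3 * v" | "7 * \<xi> > 8 + 3 * v" by fastforce
    then show ?thesis
    proof cases
      case 1
      \<comment> \<open>Equating valuations and using \<open>1 - 2 * v \<le> 4 * \<zeta>\<close>
        would give \<open>\<xi> \<ge> 7 / 8\<close>.\<close>
      with ord_elim_poly_below[OF x] P \<zeta> show ?thesis by simp
    next
      case 3
      with ord_elim_poly_middle[OF x] P show ?thesis by simp
    next
      case 4
      \<comment> \<open>At the corner \<open>\<xi> - v\<close> is (8 - 4v)/7, while
        \<open>8 * \<zeta>\<close> is at most (32 - 16v)/7. This forces v = 2, then
        \<open>\<zeta> = 0\<close> and \<open>\<xi> = 2\<close>, which fits the second
        alternative.\<close>
      have "\<xi> - v \<le> 8 * \<zeta>" using ord_elim_poly_corner[OF x 4] unfolding P by (simp only: ereal_less_eq)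
      then have "v \<le> 2" using 4 \<zeta> v_ge by linarith
      with v_ge have "v = 2" by (rule order_antisym[rotated])
      with 4 \<zeta> \<open>\<xi> - v \<le> 8 * \<zeta>\<close> show ?thesis by simp
    next
      case 5
      \<comment> \<open>The same comparison, now strict, would give v < 2.\<close>
      with ord_elim_poly_above[OF x] P have "\<xi> - v = 8 * \<zeta>" by simp
      with 5 \<zeta> v_ge show ?thesis by linarith
    qed simp
  qed
  \<comment> \<open>For \<open>\<xi> = \<zeta> + 1 + v / 2\<close> the upper bound follows from
    \<open>7 * \<zeta> \<le> 4 - 2 * v\<close> and v at least 2; the lower bound and the dominance
    over \<open>zp^4\<close> follow from \<open>1 - 2 * v \<le> 4 * \<zeta>\<close>.\<close>
  then have \<xi>: "1 / 2 \<le> \<xi> \<and> 7 * \<xi> \<le> 8 + 3 * v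
      \<and> 2 * \<xi> - 2 - 2 * v < 4 * \<zeta> \<and> 2 * \<xi> - 2 - 2 * v < 2 / 3"
    using \<zeta> \<zeta>0 v_ge by (elim disjE) (hypsubst, intro conjI, linarith+)+
  then have "ord z = ereal ((\<xi> - v) / 2)"
    by (intro ord_z_step[OF rec x]) (simp_all add: o)
  with x show ?thesis
    by (rule trappedI) (use \<xi> in simp_all)
qed

lemma recurrence_trivial:
  fixes x z :: "nat \<Rightarrow> 'a"
  assumes start: "recurrence 0 0 (x 0) (z 0)"
    and step: "\<And>n. recurrence (x n) (z n) (x (Suc n)) (z (Suc n))"
    and lim: "(\<lambda>n. ord (z n)) \<longlonglongrightarrow> \<infinity>"
  shows "x n = 0 \<and> z n = 0"
proof (rule ccontr)
  assume "\<not> (x n = 0 \<and> z n = 0)"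
  then have ex: "x n \<noteq> 0 \<or> z n \<noteq> 0" by blast
  define m where "m = (LEAST n. x n \<noteq> 0 \<or> z n \<noteq> 0)"
  have m: "x m \<noteq> 0 \<or> z m \<noteq> 0"
    unfolding m_def using ex by (rule LeastI)
  have before: "x k = 0 \<and> z k = 0" if "k < m" for k
    using not_less_Least[of k] that unfolding m_def by blast
  \<comment> \<open>The pair before the first nonzero one is zero or does not exist; in both cases
    the homogeneous equation holds.\<close>
  have "recurrence 0 0 (x m) (z m)"
  proof (cases m)
    case 0
    with start show ?thesis by simp
  next
    case (Suc k)
    with step[of k] before[of k] show ?thesis by simp
  qed
  then have trapped_m: "trapped (x m) (z m)" by (rule trapped_start) (rule m)
  have trapped: "trapped (x k) (z k)" if "m \<le> k" for k
    using that
  proof (induction k rule: nat_induct_at_least)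
    case base
    show ?case by (rule trapped_m)
  next
    case (Suc k)
    then show ?case by (blast intro: trapped_step[OF step])
  qed
  have "eventually (\<lambda>n. ord (z n) > 0) sequentially"
    using order_tendstoD(1)[OF lim, of 0] by simp
  then obtain N where "ord (z k) > 0" if "k \<ge> N" for k
    unfolding eventually_sequentially by blast
  then have "ord (z (max m N)) > 0" by simp
  \<comment> \<open>Trapped pairs have \<open>7 * ord z\<close> at most 4 - 2v, which is not
    positive.\<close>
  with trapped[of "max m N"] v_ge show False
    unfolding trapped_def by (auto simp: zero_ereal_def)
qed

end

theorem proposition8p2:
  fixes ord :: "'a::field \<Rightarrow> ereal" and \<theta> a11 a12 a21 :: 'a and v :: real and t :: ereal
  assumes "is_C_infinity ord \<theta>"
    and "ord a11 = -1"
    and "a21 \<noteq> 0"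
    and "ord a21 = ereal v"
    and "t = ord (\<theta>^2 / a21 + \<theta>^4 / a21^4 - a12^2)"
    and "v \<ge> 2"
    and "t \<ge> ereal (- (16 / 7) * v - 24 / 7)"
  shows "h1 ord \<theta> (vector [vector [a11, a12], vector [a21, 0]] :: 'a ^ 2 ^ 2) = 0"
proof -
  have inf: "CHAR('a) = 2" "is_valuation ord" "ord \<theta> = -1"
    using assms(1) by (simp_all add: is_C_infinity_def)
  let ?A = "vector [vector [a11, a12], vector [a21, 0]] :: 'a ^ 2 ^ 2"
  interpret anderson_motive ord \<theta> ?A
    by unfold_locales (simp_all add: inf)
  interpret motive_valuation ord \<theta> a11 a12 a21 v "\<theta>^2 / a21 + \<theta>^4 / a21^4 - a12^2"
    by unfold_locales (use assms inf in \<open>simp_all add: one_ereal_def\<close>)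
  show ?thesis
  proof (rule h1_eq_0)
    fix y :: "nat \<Rightarrow> 'a ^ 2"
    assume lim: "\<And>i. (\<lambda>n. ord (y n $ i)) \<longlonglongrightarrow> \<infinity>"
      and eq: "\<And>n i. \<theta>^2 * (y n $ i)^4 + (\<Sum>j\<in>UNIV. ?A $ j $ i * (y n $ j)^2) + y n $ i =
        (if n = 0 then 0 else (y (n - 1) $ i)^4)"
    \<comment> \<open>The zero pair stands in for the missing predecessor of index 0.\<close>
    have rec: "recurrence (if n = 0 then 0 else y (n - 1) $ 1) (if n = 0 then 0 else y (n - 1) $ 2) (y n $ 1) (y n $ 2)" for n
      using eq[of n 1] eq[of n 2] by (auto simp: recurrence_def sum_2 vector_2 algebra_simps)
    have "y n $ 1 = 0 \<and> y n $ 2 = 0" for n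
      by (rule recurrence_trivial[of "\<lambda>n. y n $ 1" "\<lambda>n. y n $ 2"])
        (use rec[of 0] rec[of "Suc _"] lim in simp_all)
    then show "\<forall>n. y n = 0"
      by (simp add: vec_eq_iff forall_2)
  qed
qed

end
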